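(* If the Markov random cocycle $(\underline A,P,q)$ has both singular (rank one) and invertible components and $P$ is primitive, then $$L_1(\underline A)=\int_{\mathscr{A}\times\mathbb{P}^1}\Psi\,d\eta,\qquad\text{where}\quad \Psi(j,\hat v)=\sum_{i\in\mathscr{A}}p_{ij}\log\frac{\|A_iv\|}{\|v\|}\in[-\infty,\infty),$$ and $\eta$ is the unique $\mathcal{Q}$-stationary probability measure.
   Context: $\mathscr{A}=\{1,\dots,k\}=\mathscr{A}_{\mathrm{sing}}\sqcup\mathscr{A}_{\mathrm{inv}}$ both nonempty; $\mathrm{rank}A_i=1$ ($i\in\mathscr{A}_{\mathrm{sing}}$), $A_i$ invertible ($i\in\mathscr{A}_{\mathrm{inv}}$). $P=(p_{ij})$ primitive left stochastic ($p_{ij}$ = probability of $j\to i$), $Pq=q$, $\mu$ the associated Markov measure on $\mathscr{A}^{\mathbb{Z}}$, $L_1(\underline A)=\lim_n\frac1n\log\|A_{\omega_n}\cdots A_{\omega_1}\|$ $\mu$-a.e. Projective action: $\hat A\hat v=\widehat{Av}$ for invertible $A$, constant map to $\widehat{\mathrm{Range}A}$ for rank one $A$. $(\mathcal{Q}\varphi)(j,\hat v)=\sum_i\varphi(i,\hat A_i\hat v)p_{ij}$; $\eta$ stationary means $\int\mathcal{Q}\varphi\,d\eta=\int\varphi\,d\eta$ for bounded measurable $\varphi$. Explicitly $\eta=\sum_jq_j\delta_j\times\eta_j$ with $\eta_j=\frac1{q_j}\sum_{s\in\mathscr{A}_{\mathrm{sing}}}q_s\sum_{n\ge1}\sum_{\underline\omega\in\mathscr{B}_n(s,j)}p(\underline\omega)\delta_{\hat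 A^n(\underline\omega)\hat r_s}$ ($\mathscr{B}_n(s,j)$: words $(\omega_0,\dots,\omega_n)$, $\omega_0=s,\omega_n=j$, interior letters in $\mathscr{A}_{\mathrm{inv}}$; $A^n(\underline\omega)=A_{\omega_n}\cdots A_{\omega_1}$; $p(\underline\omega)=\prod p_{\omega_l\omega_{l-1}}$; $r_s$ the range of $A_s$). *)

theory Defs
  imports "HOL-Probability.Probability"
begin

type_synonym mat2 = "real^2^2"

definition lines :: "(real^2) set set" where
  "lines = {span {v} | v. v \<noteq> 0}"

text \<open>Borel structure on P^1: the quotient (final) sigma-algebra of
  R^2 minus 0 under v \<mapsto> its line.\<close>
definition P1 :: "(real^2) set measure" where
  "P1 = measure_of lines
     {S. S \<subseteq> lines \<and> {v. v \<noteq> 0 \<and> span {v} \<in> S} \<in> sets borel} (\<lambda>_. 0)"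

text \<open>Projective action of a matrix that is invertible or of rank one.\<close>
definition pact :: "mat2 \<Rightarrow> (real^2) set \<Rightarrow> (real^2) set" where
  "pact M l = (if invertible M then (\<lambda>x. M *v x) ` l else range (\<lambda>x. M *v x))"

definition rep :: "(real^2) set \<Rightarrow> real^2" where
  "rep l = (SOME v. v \<in> l \<and> v \<noteq> 0)"

definition eln :: "real \<Rightarrow> ereal" where
  "eln x = (if x = 0 then - \<infinity> else ereal (ln x))"

definition mnorm :: "mat2 \<Rightarrow> real" where
  "mnorm M = onorm (\<lambda>x. M *v x)"

definition eintegral :: "'b measure \<Rightarrow> ('b \<Rightarrow> ereal) \<Rightarrow> ereal" where
  "eintegral M f = enn2ereal (\<integral>\<^sup>+ x. e2ennreal (f x) \<partial>M)
                 - enn2ereal (\<integral>\<^sup>+ x. e2ennreal (- f x) \<partial>M)"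

definition SP :: "('a \<times> (real^2) set) measure" where
  "SP = count_space UNIV \<Otimes>\<^sub>M P1"

text \<open>Markov operator Q; p i j is the probability of the transition j \<rightarrow> i.\<close>
definition Qop :: "('a::finite \<Rightarrow> mat2) \<Rightarrow> ('a \<Rightarrow> 'a \<Rightarrow> real)
     \<Rightarrow> ('a \<times> (real^2) set \<Rightarrow> real) \<Rightarrow> 'a \<times> (real^2) set \<Rightarrow> real" where
  "Qop A p \<phi> = (\<lambda>(j, l). \<Sum>i\<in>UNIV. \<phi> (i, pact (A i) l) * p i j)"

definition stationary :: "('a::finite \<Rightarrow> mat2) \<Rightarrow> ('a \<Rightarrow> 'a \<Rightarrow> real)
     \<Rightarrow> ('a \<times> (real^2) set) measure \<Rightarrow> bool" where
  "stationary A p \<eta> \<longleftrightarrow> prob_space \<eta> \<and> sets \<eta> = sets SP \<and>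
     (\<forall>\<phi>. \<phi> \<in> borel_measurable SP \<longrightarrow> (\<exists>B. \<forall>x\<in>space SP. \<bar>\<phi> x\<bar> \<le> B) \<longrightarrow>
        (\<integral>x. Qop A p \<phi> x \<partial>\<eta>) = (\<integral>x. \<phi> x \<partial>\<eta>))"

definition Psi :: "('a::finite \<Rightarrow> mat2) \<Rightarrow> ('a \<Rightarrow> 'a \<Rightarrow> real)
     \<Rightarrow> 'a \<times> (real^2) set \<Rightarrow> ereal" where
  "Psi A p = (\<lambda>(j, l). \<Sum>i\<in>UNIV. ereal (p i j) *
                 eln (norm (A i *v rep l) / norm (rep l)))"

fun ppow :: "('a::finite \<Rightarrow> 'a \<Rightarrow> real) \<Rightarrow> nat \<Rightarrow> 'a \<Rightarrow> 'a \<Rightarrow> real" where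
  "ppow p 0 = (\<lambda>i j. if i = j then 1 else 0)"
| "ppow p (Suc n) = (\<lambda>i j. \<Sum>l\<in>UNIV. p i l * ppow p n l j)"

definition left_stochastic :: "('a::finite \<Rightarrow> 'a \<Rightarrow> real) \<Rightarrow> bool" where
  "left_stochastic p \<longleftrightarrow> (\<forall>i j. 0 \<le> p i j) \<and> (\<forall>j. (\<Sum>i\<in>UNIV. p i j) = 1)"

definition primitive :: "('a::finite \<Rightarrow> 'a \<Rightarrow> real) \<Rightarrow> bool" where
  "primitive p \<longleftrightarrow> (\<exists>n. \<forall>i j. 0 < ppow p n i j)"

definition seqspace :: "(int \<Rightarrow> 'a) measure" where
  "seqspace = (\<Pi>\<^sub>M n\<in>UNIV. count_space UNIV)"

definition markov_measure :: "('a::finite \<Rightarrow> 'a \<Rightarrow> real) \<Rightarrow> ('a \<Rightarrow> real)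
     \<Rightarrow> (int \<Rightarrow> 'a) measure \<Rightarrow> bool" where
  "markov_measure p q \<mu> \<longleftrightarrow> prob_space \<mu> \<and> sets \<mu> = sets seqspace \<and>
     (\<forall>(m::int) (n::nat) (w::int \<Rightarrow> 'a).
        measure \<mu> {\<omega> \<in> space \<mu>. \<forall>l\<in>{m..m + int n}. \<omega> l = w l}
        = q (w m) * (\<Prod>l\<in>{m..<m + int n}. p (w (l + 1)) (w l)))"

fun cocycle :: "('a \<Rightarrow> mat2) \<Rightarrow> (int \<Rightarrow> 'a) \<Rightarrow> nat \<Rightarrow> mat2" where
  "cocycle A \<omega> 0 = mat 1"
| "cocycle A \<omega> (Suc n) = A (\<omega> (int (Suc n))) ** cocycle A \<omega> n"

end

theory Submission
  imports Defs
begin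

text \<open>Almost every two-sided sequence has a singular letter in its past, so that the line \<open>dir \<omega>\<close>
  obtained by pushing the range of the last singular matrix forward to time 0 is a function of
  the past, equivariant under the shift. Its joint law with \<open>\<omega> 0\<close> is the stationary measure:
  stationarity combines shift invariance with the Markov property, and uniqueness holds because
  the iterates of the Markov operator forget the line as soon as a singular letter is read.
  After the first positive time with a singular letter the range of the cocycle lies in the line
  of the shifted sequence, so from then on its norm is multiplied at each step by the stretching
  factor of that line. The logarithm of the norm is thus a Birkhoff sum for the mixing
  Markov shift, and its average converges to the integral of \<open>\<Psi>\<close>, also when the latter is \<open>-\<infinity>\<close>.\<close>

section \<open>The ergodic theorem\<close>

text \<open>The ergodic average and the integral of \<open>Psi\<close> agree because
  \<open>Psi\<close> is the mean, conditional on the past, of the log stretching factor at the next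
  letter: the line is a function of the past alone, so the Markov property applies to it. Ergodicity
  is reached through mixing. On cylinders mixing is just convergence of the powers of
  \<open>p\<close>, and it extends to all events, whereas an invariant event cannot be inspected on
  cylinders. The norm of a product is not multiplicative in general; it becomes so after a singular
  letter because the whole range then sits in one line. The obstacle is that a later singular matrix
  may annihilate this line. The product then stays 0, logarithms become -infinity, and an ergodic
  theorem for integrable functions is not enough.\<close>

locale ergodic_map = prob_space +
  fixes T :: "'a \<Rightarrow> 'a"
  assumes T_measurable [measurable]: "T \<in> measurable M M"
    and distr_T: "distr M M T = M"
    and zero_one: "\<And>E. E \<in> sets M \<Longrightarrow> T -` E \<inter> space M = E \<Longrightarrow> prob E = 0 \<or> prob E = 1"
begin

lemma T_funpow_measurable [measurable]: "(T ^^ n) \<in> measurable M M"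
  by (induction n) (auto simp: id_def intro: measurable_comp)

lemma integral_comp_T:
  fixes f :: "'a \<Rightarrow> real"
  assumes [measurable]: "f \<in> borel_measurable M"
  shows "(\<integral>x. f (T x) \<partial>M) = (\<integral>x. f x \<partial>M)"
  using integral_distr[of T M M f] distr_T by simp

lemma integrable_comp_T:
  fixes f :: "'a \<Rightarrow> real"
  assumes "integrable M f"
  shows "integrable M (\<lambda>x. f (T x))"
  using assms integrable_distr[of T M M f] distr_T by simp

lemma distr_funpow: "distr M M (T ^^ n) = M"
proof (induction n)
  case 0
  show ?case by (simp add: id_def distr_id2)
next
  case (Suc n)
  have "distr M M (T ^^ Suc n) = distr (distr M M (T ^^ n)) M T"
    by (subst distr_distr) auto
  then show ?case by (simp only: Suc distr_T)
qed

lemma AE_funpow: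
  assumes "AE x in M. P x"
  shows "AE x in M. \<forall>n. P ((T ^^ n) x)"
proof -
  have "AE x in M. P ((T ^^ n) x)" for n
  proof -
    have "AE x in distr M M (T ^^ n). P x" unfolding distr_funpow by (rule assms)
    then show ?thesis by (rule AE_distrD[rotated]) measurable
  qed
  then show ?thesis by (simp add: AE_all_countable)
qed

text \<open>\<open>run f n x\<close> is the maximum of the Birkhoff sums of \<open>f\<close> at \<open>x\<close> of lengths \<open>1, \<dots>, n + 1\<close>.\<close>

primrec run :: "('a \<Rightarrow> real) \<Rightarrow> nat \<Rightarrow> 'a \<Rightarrow> real" where
  "run f 0 = f"
| "run f (Suc n) = (\<lambda>x. f x + max 0 (run f n (T x)))"

lemma run_mono: "run f n x \<le> run f (Suc n) x"
proof (induction n arbitrary: x)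
  case (Suc n)
  show ?case using Suc[of "T x"] by (auto simp: max_def)
qed simp

lemma run_incseq: "incseq (\<lambda>n. run f n x)"
  by (intro incseq_SucI run_mono)

lemma integrable_run:
  assumes "integrable M f"
  shows "integrable M (run f n)"
proof (induction n)
  case (Suc n)
  show ?case
    using integrable_comp_T[OF Suc] assms by (auto intro!: Bochner_Integration.integrable_add)
qed (simp add: assms)

lemma sum_le_run: "(\<Sum>k<Suc n. f ((T ^^ k) x)) \<le> run f n x"
proof (induction n arbitrary: x)
  case (Suc n)
  have "(\<Sum>k<Suc (Suc n). f ((T ^^ k) x)) = f x + (\<Sum>k<Suc n. f ((T ^^ k) (T x)))"
    by (subst sum.lessThan_Suc_shift) (simp add: funpow_swap1)
  also have "\<dots> \<le> f x + run f n (T x)" using Suc by simp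
  finally show ?case by (auto simp: max_def)
qed simp

text \<open>If the Birkhoff sums were unbounded almost everywhere, then
  \<open>run f (Suc n) - run f n \<circ> T\<close>, whose integral is nonnegative by invariance,
  would converge to \<open>f\<close>.\<close>

lemma birkhoff_sum_bounded:
  fixes f :: "'a \<Rightarrow> real"
  assumes f: "integrable M f" and neg: "(\<integral>x. f x \<partial>M) < 0"
  shows "AE x in M. \<exists>B. \<forall>n. (\<Sum>k<n. f ((T ^^ k) x)) \<le> B"
proof -
  have [measurable]: "f \<in> borel_measurable M" using f by simp
  have [measurable]: "run f n \<in> borel_measurable M" for n
    using integrable_run[OF f] by simp
  \<comment> \<open>Thresholds in \<open>nat\<close> keep the quantifiers countable, so
    \<open>A\<close> is measurable; \<open>A_alt\<close> restores real thresholds.\<close>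
  define A where "A = {x \<in> space M. \<forall>B::nat. \<exists>n. run f n x > real B}"
  have A [measurable]: "A \<in> sets M" unfolding A_def by measurable
  have A_alt: "x \<in> A \<longleftrightarrow> x \<in> space M \<and> (\<forall>B::real. \<exists>n. run f n x > B)" for x
    unfolding A_def mem_Collect_eq using real_arch_simple
    by (metis (no_types, lifting) order.strict_trans1)
  \<comment> \<open>Where the maxima are large, \<open>run f (Suc n) x\<close> and
    \<open>run f n (T x)\<close> differ by \<open>f x\<close> only, so unboundedness passes both
    ways along the orbit.\<close>
  have inv: "T x \<in> A \<longleftrightarrow> x \<in> A" if "x \<in> space M" for x
  proof -
    have Tx: "T x \<in> space M" using that T_measurable by (rule measurable_space[rotated])
    have "(\<forall>B. \<exists>n. run f n (T x) > B) \<longleftrightarrow> (\<forall>B. \<exists>n. run f n x > B)"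
    proof safe
      fix B assume "\<forall>B. \<exists>n. run f n (T x) > B"
      then obtain n where "run f n (T x) > B - f x" by blast
      then have "run f (Suc n) x > B" by simp
      then show "\<exists>n. run f n x > B" by blast
    next
      fix B assume "\<forall>B. \<exists>n. run f n x > B"
      then obtain n where "run f n x > \<bar>B\<bar> + f x" by blast
      then have "run f (Suc n) x > \<bar>B\<bar> + f x" using run_mono[of f n x] by linarith
      then have "run f n (T x) > B" by (simp add: max_def split: if_splits)
      then show "\<exists>n. run f n (T x) > B" by blast
    qed
    then show ?thesis using that Tx A_alt by simp
  qed
  have "T -` A \<inter> space M = A"
    using inv sets.sets_into_space[OF A] by blast
  then have "prob A = 0 \<or> prob A = 1" using zero_one A by blast
  moreover have "prob A \<noteq> 1"
  proof
    assume "prob A = 1"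
    then have AE_A: "AE x in M. x \<in> A" using prob_eq_1[OF A] by simp
    have lim: "(\<lambda>n. \<integral>x. run f (Suc n) x - run f n (T x) \<partial>M) \<longlonglongrightarrow> (\<integral>x. f x \<partial>M)"
    proof (rule integral_dominated_convergence)
      \<comment> \<open>The difference is \<open>f x + max 0 (- run f n (T x))\<close>, and
        \<open>run f n\<close> is at least \<open>run f 0 = f\<close>.\<close>
      show "integrable M (\<lambda>x. \<bar>f x\<bar> + \<bar>f (T x)\<bar>)"
        using f integrable_comp_T[OF f] by auto
      show "AE x in M. (\<lambda>n. run f (Suc n) x - run f n (T x)) \<longlonglongrightarrow> f x"
        using AE_A
      proof (rule AE_mp, intro AE_I2 impI)
        fix x assume "x \<in> space M" "x \<in> A"
        then have "T x \<in> A" using inv by blast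
        then obtain N where N: "run f N (T x) > 0" using A_alt by blast
        have "run f (Suc n) x - run f n (T x) = f x" if "n \<ge> N" for n
          using N incseqD[OF run_incseq that, of f "T x"] by (simp add: max_def)
        then show "(\<lambda>n. run f (Suc n) x - run f n (T x)) \<longlonglongrightarrow> f x"
          by (intro tendsto_eventually eventually_sequentiallyI)
      qed
      fix n
      have "norm (run f (Suc n) x - run f n (T x)) \<le> \<bar>f x\<bar> + \<bar>f (T x)\<bar>" for x
        using incseqD[OF run_incseq, of 0 n f "T x"] by (auto simp: max_def)
      then show "AE x in M. norm (run f (Suc n) x - run f n (T x)) \<le> \<bar>f x\<bar> + \<bar>f (T x)\<bar>"
        by simp
    qed measurable
    have "(\<integral>x. run f (Suc n) x - run f n (T x) \<partial>M) \<ge> 0" for n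
    proof -
      have "(\<integral>x. run f (Suc n) x - run f n (T x) \<partial>M) = (\<integral>x. run f (Suc n) x \<partial>M) - (\<integral>x. run f n x \<partial>M)"
        using integrable_run[OF f, of "Suc n"] integrable_run[OF f, of n]
          integrable_comp_T[OF integrable_run[OF f, of n]]
        by (subst Bochner_Integration.integral_diff) (auto simp: integral_comp_T simp del: run.simps)
      moreover have "(\<integral>x. run f n x \<partial>M) \<le> (\<integral>x. run f (Suc n) x \<partial>M)"
        by (intro integral_mono integrable_run f run_mono)
      ultimately show ?thesis by linarith
    qed
    then have "0 \<le> (\<integral>x. f x \<partial>M)" using lim by (intro LIMSEQ_le_const[OF lim]) auto
    then show False using neg by simp
  qed
  ultimately have "AE x in M. x \<notin> A" using A by (simp add: prob_eq_0)
  then show ?thesis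
  proof (rule AE_mp, intro AE_I2 impI)
    fix x assume "x \<in> space M" "x \<notin> A"
    then obtain B where B: "\<And>n. run f n x \<le> B" using A_alt by (meson not_less)
    have "(\<Sum>k<n. f ((T ^^ k) x)) \<le> max 0 B" for n
    proof (cases n)
      case (Suc m)
      then show ?thesis using sum_le_run[of f x m] B[of m] by simp
    qed simp
    then show "\<exists>B. \<forall>n. (\<Sum>k<n. f ((T ^^ k) x)) \<le> B" by blast
  qed
qed

text \<open>Subtracting slightly more than the mean leaves a function of negative integral, whose
  Birkhoff sums are bounded above. Letting the slack run through a sequence keeps a single null
  set.\<close>

lemma birkhoff_upper:
  assumes f: "integrable M f"
  shows "AE x in M. \<forall>m. \<exists>B. \<forall>n. (\<Sum>k<n. f ((T ^^ k) x)) \<le> real n * ((\<integral>x. f x \<partial>M) + 1 / real (Suc m)) + B"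
proof -
  have "AE x in M. \<exists>B. \<forall>n. (\<Sum>k<n. f ((T ^^ k) x)) \<le> real n * ((\<integral>x. f x \<partial>M) + 1 / real (Suc m)) + B" for m
  proof -
    let ?c = "(\<integral>x. f x \<partial>M) + 1 / real (Suc m)"
    have "AE x in M. \<exists>B. \<forall>n. (\<Sum>k<n. f ((T ^^ k) x) - ?c) \<le> B"
      using f by (intro birkhoff_sum_bounded[of "\<lambda>x. f x - ?c"]) (auto simp: prob_space)
    then show ?thesis
      by (rule AE_mp) (auto intro!: AE_I2 simp: sum_subtractf algebra_simps)
  qed
  then show ?thesis by (simp add: AE_all_countable)
qed

lemma eventually_le_average:
  assumes "\<forall>m. \<exists>B::real. \<forall>n. s n \<le> real n * (c + 1 / real (Suc m)) + B" and "e > 0"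
  shows "eventually (\<lambda>n. s n / real n < c + e) sequentially"
proof -
  obtain m where m: "1 / real (Suc m) < e / 2"
    using nat_approx_posE[of "e/2"] assms(2) by auto
  obtain B where B: "\<And>n. s n \<le> real n * (c + 1 / real (Suc m)) + B" using assms(1) by blast
  have "(\<lambda>n. B / real n) \<longlonglongrightarrow> 0" by (rule lim_const_over_n)
  then have "eventually (\<lambda>n. B / real n < e / 2) sequentially"
    using assms(2) by (intro order_tendstoD) auto
  then show ?thesis using eventually_gt_at_top[of 0]
  proof eventually_elim
    case (elim n)
    have "s n / real n \<le> (real n * (c + 1 / real (Suc m)) + B) / real n"
      using B by (intro divide_right_mono) auto
    also have "\<dots> = c + 1 / real (Suc m) + B / real n" using elim by (simp add: field_simps)
    finally show ?case using elim m by linarith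
  qed
qed

text \<open>The upper bound for \<open>- f\<close> is the lower bound for \<open>f\<close>.\<close>

theorem birkhoff_integrable:
  assumes f: "integrable M f"
  shows "AE x in M. (\<lambda>n. (\<Sum>k<n. f ((T ^^ k) x)) / real n) \<longlonglongrightarrow> (\<integral>x. f x \<partial>M)"
proof -
  have "integrable M (\<lambda>x. - f x)" using f by simp
  from birkhoff_upper[OF f] birkhoff_upper[OF this] show ?thesis
  proof eventually_elim
    case (elim x)
    show ?case
    proof (rule tendstoI)
      fix e :: real assume e: "e > 0"
      show "eventually (\<lambda>n. dist ((\<Sum>k<n. f ((T ^^ k) x)) / real n) (\<integral>x. f x \<partial>M) < e) sequentially"
        using eventually_le_average[OF elim(1) e] eventually_le_average[OF elim(2) e]
        by eventually_elim (auto simp: dist_real_def sum_negf)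
    qed
  qed
qed

text \<open>If the mean is finite, this is the integrable case for \<open>enn2real (g x)\<close>. If
  it is infinite, the averages dominate those of \<open>min (g x) (of_nat m)\<close>, whose limits
  grow to infinity with \<open>m\<close> by monotone convergence.\<close>

theorem birkhoff_ennreal:
  fixes g :: "'a \<Rightarrow> ennreal"
  assumes [measurable]: "g \<in> borel_measurable M"
  shows "AE x in M. (\<lambda>n. (\<Sum>k<n. g ((T ^^ k) x)) / of_nat n) \<longlonglongrightarrow> (\<integral>\<^sup>+ x. g x \<partial>M)"
proof (cases "(\<integral>\<^sup>+ x. g x \<partial>M) = \<infinity>")
  case False
  then have fin: "AE x in M. g x \<noteq> \<infinity>" by (intro nn_integral_PInf_AE) auto
  have eq: "AE x in M. ennreal (enn2real (g x)) = g x" using fin by eventually_elim (simp add: less_top)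
  have nn: "(\<integral>\<^sup>+ x. ennreal (enn2real (g x)) \<partial>M) = (\<integral>\<^sup>+ x. g x \<partial>M)" by (rule nn_integral_cong_AE[OF eq])
  have int: "integrable M (\<lambda>x. enn2real (g x))"
    using False by (intro integrableI_nonneg) (auto simp: nn less_top)
  have I: "ennreal (\<integral>x. enn2real (g x) \<partial>M) = (\<integral>\<^sup>+ x. g x \<partial>M)"
    using nn_integral_eq_integral[OF int] nn by simp
  from birkhoff_integrable[OF int] AE_funpow[OF eq] show ?thesis
  proof eventually_elim
    case (elim x)
    have "(\<lambda>n. ennreal ((\<Sum>k<n. enn2real (g ((T ^^ k) x))) / real n)) \<longlonglongrightarrow> (\<integral>\<^sup>+ x. g x \<partial>M)"
      unfolding I[symmetric] using elim(1) by (rule tendsto_ennrealI)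
    moreover have "eventually (\<lambda>n. ennreal ((\<Sum>k<n. enn2real (g ((T ^^ k) x))) / real n)
        = (\<Sum>k<n. g ((T ^^ k) x)) / of_nat n) sequentially"
      using eventually_gt_at_top[of 0]
    proof eventually_elim
      case (elim n)
      then show ?case
        using \<open>\<forall>n. ennreal (enn2real (g ((T ^^ n) x))) = g ((T ^^ n) x)\<close>
        by (subst divide_ennreal[symmetric])
          (auto simp: sum_nonneg ennreal_of_nat_eq_real_of_nat sum_ennreal[symmetric] simp del: sum_ennreal)
    qed
    ultimately show ?case by (rule Lim_transform_eventually)
  qed
next
  case True
  have lim: "AE x in M. (\<lambda>n. (\<Sum>k<n. enn2real (min (g ((T ^^ k) x)) (of_nat m))) / real n)
      \<longlonglongrightarrow> (\<integral>x. enn2real (min (g x) (of_nat m)) \<partial>M)" for m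
  proof (rule birkhoff_integrable)
    have "enn2real (min (g x) (of_nat m)) \<le> real m" for x
      by (rule enn2real_leI) (auto simp: ennreal_of_nat_eq_real_of_nat)
    then show "integrable M (\<lambda>x. enn2real (min (g x) (of_nat m)))"
      by (intro integrable_const_bound[of _ "real m"]) auto
  qed
  have fin: "min (g x) (of_nat m) < top" for x m
    by (simp add: min_less_iff_disj of_nat_less_top)
  have I: "ennreal (\<integral>x. enn2real (min (g x) (of_nat m)) \<partial>M) = (\<integral>\<^sup>+ x. min (g x) (of_nat m) \<partial>M)" for m
  proof -
    have "enn2real (min (g x) (of_nat m)) \<le> real m" for x
      by (rule enn2real_leI) (auto simp: ennreal_of_nat_eq_real_of_nat)
    then have "integrable M (\<lambda>x. enn2real (min (g x) (of_nat m)))"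
      by (intro integrable_const_bound[of _ "real m"]) auto
    from nn_integral_eq_integral[OF this] show ?thesis using fin by simp
  qed
  have "(SUP m. \<integral>\<^sup>+ x. min (g x) (of_nat m) \<partial>M) = (\<integral>\<^sup>+ x. (SUP m. min (g x) (of_nat m)) \<partial>M)"
    by (rule nn_integral_monotone_convergence_SUP[symmetric])
      (auto simp: incseq_def le_fun_def intro: min.coboundedI2)
  also have "(\<lambda>x. SUP m. min (g x) (of_nat m)) = g"
  proof
    fix x
    have "(SUP m. min (g x) (of_nat m)) = min (g x) (SUP m. of_nat m)"
      by (simp add: inf_min[symmetric] inf_SUP)
    then show "(SUP m. min (g x) (of_nat m)) = g x" by (simp add: ennreal_SUP_of_nat_eq_top)
  qed
  finally have sup: "(SUP m. \<integral>\<^sup>+ x. min (g x) (of_nat m) \<partial>M) = top" using True by simp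
  have "AE x in M. \<forall>m. (\<lambda>n. (\<Sum>k<n. enn2real (min (g ((T ^^ k) x)) (of_nat m))) / real n)
      \<longlonglongrightarrow> (\<integral>x. enn2real (min (g x) (of_nat m)) \<partial>M)"
    using lim by (simp add: AE_all_countable)
  then show ?thesis
  proof eventually_elim
    case (elim x)
    have "(\<lambda>n. (\<Sum>k<n. g ((T ^^ k) x)) / of_nat n) \<longlonglongrightarrow> top"
    proof (rule order_tendstoI)
      fix a :: ennreal assume "a < top"
      then obtain m where m: "a < (\<integral>\<^sup>+ x. min (g x) (of_nat m) \<partial>M)"
        using sup by (metis less_SUP_iff)
      have "(\<lambda>n. ennreal ((\<Sum>k<n. enn2real (min (g ((T ^^ k) x)) (of_nat m))) / real n))
        \<longlonglongrightarrow> (\<integral>\<^sup>+ x. min (g x) (of_nat m) \<partial>M)"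
        unfolding I[symmetric] using elim by (intro tendsto_ennrealI) blast
      then have "eventually (\<lambda>n. a < ennreal ((\<Sum>k<n. enn2real (min (g ((T ^^ k) x)) (of_nat m))) / real n)) sequentially"
        using m by (rule order_tendstoD)
      then show "eventually (\<lambda>n. a < (\<Sum>k<n. g ((T ^^ k) x)) / of_nat n) sequentially"
        using eventually_gt_at_top[of 0]
      proof eventually_elim
        case (elim n)
        note elim(1)
        also have "ennreal ((\<Sum>k<n. enn2real (min (g ((T ^^ k) x)) (of_nat m))) / real n)
          = (\<Sum>k<n. min (g ((T ^^ k) x)) (of_nat m)) / of_nat n"
          using elim(2) fin
          by (subst divide_ennreal[symmetric])
            (auto simp: sum_nonneg ennreal_of_nat_eq_real_of_nat sum_ennreal[symmetric] simp del: sum_ennreal)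
        also have "\<dots> \<le> (\<Sum>k<n. g ((T ^^ k) x)) / of_nat n"
          by (intro divide_right_mono_ennreal sum_mono) simp
        finally show ?case .
      qed
    qed auto
    then show ?case using True by simp
  qed
qed

end

section \<open>Primitive stochastic matrices\<close>

locale primitive_chain =
  fixes p :: "'a::finite \<Rightarrow> 'a \<Rightarrow> real" and q :: "'a \<Rightarrow> real"
  assumes stoch: "left_stochastic p"
    and prim: "primitive p"
    and q_nonneg: "0 \<le> q j"
    and q_sum: "(\<Sum>j\<in>UNIV. q j) = 1"
    and q_inv: "(\<Sum>j\<in>UNIV. p i j * q j) = q i"
begin

lemma p_nonneg: "0 \<le> p i j" and p_sum: "(\<Sum>i\<in>UNIV. p i j) = 1"
  using stoch by (auto simp: left_stochastic_def)

lemma ppow_nonneg: "0 \<le> ppow p n i j"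
  by (induction n arbitrary: i) (auto intro!: sum_nonneg simp: p_nonneg)

lemma ppow_sum: "(\<Sum>i\<in>UNIV. ppow p n i j) = 1"
proof (induction n)
  case (Suc n)
  have "(\<Sum>i\<in>UNIV. ppow p (Suc n) i j) = (\<Sum>l\<in>UNIV. (\<Sum>i\<in>UNIV. p i l) * ppow p n l j)"
    by (simp add: sum_distrib_right) (rule sum.swap)
  then show ?case using Suc by (simp add: p_sum)
qed simp

lemma ppow_fixed:
  assumes "\<And>i. (\<Sum>j\<in>UNIV. p i j * x j) = x i"
  shows "(\<Sum>j\<in>UNIV. ppow p n i j * x j) = x i"
proof (induction n arbitrary: i)
  case 0
  have "(if i = j then 1 else 0) * x j = (if i = j then x j else 0)" for j by simp
  then show ?case by simp
next
  case (Suc n)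
  have "(\<Sum>j\<in>UNIV. ppow p (Suc n) i j * x j) = (\<Sum>j\<in>UNIV. \<Sum>l\<in>UNIV. p i l * (ppow p n l j * x j))"
    by (simp add: sum_distrib_right mult.assoc)
  also have "\<dots> = (\<Sum>l\<in>UNIV. \<Sum>j\<in>UNIV. p i l * (ppow p n l j * x j))" by (rule sum.swap)
  also have "\<dots> = (\<Sum>l\<in>UNIV. p i l * x l)" by (simp add: sum_distrib_left[symmetric] Suc)
  finally show ?case using assms by simp
qed

lemma ppow_add: "ppow p (m + n) i j = (\<Sum>l\<in>UNIV. ppow p m i l * ppow p n l j)"
proof (induction m arbitrary: i)
  case 0
  have "(if i = l then 1 else 0) * ppow p n l j = (if i = l then ppow p n l j else 0)" for l by simp
  then show ?case by simp
next
  case (Suc m)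
  have "ppow p (Suc m + n) i j = (\<Sum>k\<in>UNIV. \<Sum>l\<in>UNIV. p i k * ppow p m k l * ppow p n l j)"
    by (simp add: Suc sum_distrib_left mult.assoc)
  also have "\<dots> = (\<Sum>l\<in>UNIV. \<Sum>k\<in>UNIV. p i k * ppow p m k l * ppow p n l j)" by (rule sum.swap)
  finally show ?case by (simp add: sum_distrib_right)
qed

text \<open>Some \<open>q j\<close> is nonzero, and a strictly positive power of \<open>p\<close>,
  which fixes \<open>q\<close>, spreads its mass to every letter.\<close>

lemma q_pos: "0 < q i"
proof -
  obtain n where n: "\<And>i j. 0 < ppow p n i j" using prim by (auto simp: primitive_def)
  obtain j where j: "q j \<noteq> 0" using q_sum by (metis sum.neutral zero_neq_one)
  have "0 < ppow p n i j * q j" using n[of i j] j q_nonneg[of j] by simp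
  also have "\<dots> \<le> (\<Sum>j\<in>UNIV. ppow p n i j * q j)"
    by (rule member_le_sum) (auto simp: ppow_nonneg q_nonneg)
  also have "\<dots> = q i" by (rule ppow_fixed) (rule q_inv)
  finally show ?thesis .
qed

lemma q_le_1: "q i \<le> 1"
  using member_le_sum[of i UNIV q] q_nonneg q_sum by simp

text \<open>On vectors of zero sum \<open>ppow p m\<close> acts as the nonnegative matrix
  \<open>ppow p m i j - c * q i\<close>, whose columns sum to \<open>1 - c\<close>.\<close>

lemma ppow_contraction:
  assumes lower: "\<And>i j. c * q i \<le> ppow p m i j" and zero: "(\<Sum>j\<in>UNIV. y j) = 0"
  shows "(\<Sum>i\<in>UNIV. \<bar>\<Sum>j\<in>UNIV. ppow p m i j * y j\<bar>) \<le> (1 - c) * (\<Sum>j\<in>UNIV. \<bar>y j\<bar>)"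
proof -
  have eq: "(\<Sum>j\<in>UNIV. ppow p m i j * y j) = (\<Sum>j\<in>UNIV. (ppow p m i j - c * q i) * y j)" for i
    using zero by (simp add: left_diff_distrib sum_subtractf sum_distrib_left[symmetric])
  have "\<bar>\<Sum>j\<in>UNIV. (ppow p m i j - c * q i) * y j\<bar> \<le> (\<Sum>j\<in>UNIV. (ppow p m i j - c * q i) * \<bar>y j\<bar>)" for i
    by (rule order_trans[OF sum_abs]) (simp add: abs_mult lower)
  then have "(\<Sum>i\<in>UNIV. \<bar>\<Sum>j\<in>UNIV. ppow p m i j * y j\<bar>)
      \<le> (\<Sum>i\<in>UNIV. \<Sum>j\<in>UNIV. (ppow p m i j - c * q i) * \<bar>y j\<bar>)"
    unfolding eq by (rule sum_mono)
  also have "\<dots> = (\<Sum>j\<in>UNIV. \<Sum>i\<in>UNIV. (ppow p m i j - c * q i) * \<bar>y j\<bar>)" by (rule sum.swap)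
  also have "\<dots> = (\<Sum>j\<in>UNIV. (1 - c) * \<bar>y j\<bar>)"
    by (simp add: sum_distrib_right[symmetric] sum_subtractf ppow_sum sum_distrib_left[symmetric] q_sum)
  finally show ?thesis by (simp add: sum_distrib_left)
qed

text \<open>The l1 distance \<open>D n\<close> of a column from \<open>q\<close> never increases
  (one step, contraction constant 0) and drops by a factor \<open>1 - c\<close> every
  \<open>N\<close> steps, where \<open>c\<close> is the least entry of a positive power. Its limit
  \<open>L\<close> satisfies \<open>L \<le> (1 - c) * L\<close>, so it vanishes.\<close>

lemma ppow_limit: "(\<lambda>n. ppow p n i j) \<longlonglongrightarrow> q i"
proof -
  define y where "y n i = ppow p n i j - q i" for n i
  define D where "D n = (\<Sum>i\<in>UNIV. \<bar>y n i\<bar>)" for n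
  have y_add: "y (m + n) i = (\<Sum>l\<in>UNIV. ppow p m i l * y n l)" for m n i
    using ppow_fixed[of q m i] q_inv by (simp add: y_def ppow_add right_diff_distrib sum_subtractf)
  have y_zero: "(\<Sum>i\<in>UNIV. y n i) = 0" for n
    by (simp add: y_def sum_subtractf ppow_sum q_sum)
  have D_contr: "D (m + n) \<le> (1 - c) * D n" if "\<And>i j. c * q i \<le> ppow p m i j" for m n c
    unfolding D_def y_add by (rule ppow_contraction[OF that y_zero])
  obtain N where N: "\<And>i j. 0 < ppow p N i j" using prim by (auto simp: primitive_def)
  define c where "c = Min (range (\<lambda>(i, j). ppow p N i j))"
  have c_le: "c \<le> ppow p N i j" for i j
    unfolding c_def by (rule Min_le) (auto intro!: image_eqI[of _ _ "(i, j)"])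
  have "c \<in> range (\<lambda>(i, j). ppow p N i j)" unfolding c_def by (rule Min_in) auto
  then have c: "c > 0" using N by auto
  \<comment> \<open>As \<open>q i \<le> 1\<close>, the entrywise bound \<open>c\<close> yields the
    rank-one lower bound that the contraction asks for.\<close>
  have "c * q i \<le> ppow p N i j" for i j
    using order_trans[OF mult_left_le[OF q_le_1[of i], of c] c_le[of i j]] c by simp
  then have DN: "D (N + n) \<le> (1 - c) * D n" for n by (rule D_contr)
  have D_nonneg: "D n \<ge> 0" for n unfolding D_def by (intro sum_nonneg) simp
  have "decseq D"
  proof (rule decseq_SucI)
    show "D (Suc n) \<le> D n" for n using D_contr[of 0 1 n] ppow_nonneg[of 1] by simp
  qed
  then obtain L where L: "D \<longlonglongrightarrow> L" "L \<ge> 0"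
    using decseq_convergent[of D 0] D_nonneg LIMSEQ_le_const by metis
  have "L \<le> (1 - c) * L"
  proof (rule LIMSEQ_le)
    show "(\<lambda>n. D (N + n)) \<longlonglongrightarrow> L" using LIMSEQ_ignore_initial_segment[OF L(1), of N] by (simp add: add.commute)
    show "(\<lambda>n. (1 - c) * D n) \<longlonglongrightarrow> (1 - c) * L" by (intro tendsto_intros L)
  qed (use DN in auto)
  then have "c * L \<le> 0" by (simp add: algebra_simps)
  then have "L = 0" using c L(2) by (simp add: mult_le_0_iff)
  then have "D \<longlonglongrightarrow> 0" using L by simp
  moreover have "\<bar>y n i\<bar> \<le> D n" for n i unfolding D_def by (rule member_le_sum) auto
  ultimately have "(\<lambda>n. y n i) \<longlonglongrightarrow> 0" by (intro Lim_null_comparison[of "\<lambda>n. y n i" D]) auto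
  then show ?thesis unfolding y_def by (rule LIM_zero_cancel)
qed

text \<open>A fixed vector is fixed by all powers, whose columns all tend to \<open>q\<close>; in
  the limit \<open>x\<close> is \<open>q\<close> times its total mass. This will identify the letter
  marginal of a stationary measure.\<close>

lemma stationary_vector_unique:
  assumes "\<And>i. (\<Sum>j\<in>UNIV. p i j * x j) = x i" and "(\<Sum>j\<in>UNIV. x j) = 1"
  shows "x = q"
proof
  fix i
  have "(\<lambda>n. \<Sum>j\<in>UNIV. ppow p n i j * x j) \<longlonglongrightarrow> (\<Sum>j\<in>UNIV. q i * x j)"
    by (intro tendsto_intros ppow_limit)
  then have "(\<lambda>n::nat. x i) \<longlonglongrightarrow> q i"
    by (simp add: ppow_fixed[of x, OF assms(1)] sum_distrib_left[symmetric] assms(2))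
  then show "x i = q i" using LIMSEQ_unique tendsto_const by blast
qed

text \<open>The probability, starting from \<open>j\<close>, that the next \<open>n\<close> letters
  all miss \<open>S\<close>; the letter \<open>j\<close> itself is not tested.\<close>

primrec avoid :: "'a set \<Rightarrow> nat \<Rightarrow> 'a \<Rightarrow> real" where
  "avoid S 0 = (\<lambda>j. 1)"
| "avoid S (Suc n) = (\<lambda>j. \<Sum>i\<in>-S. p i j * avoid S n i)"

lemma avoid_nonneg: "0 \<le> avoid S n j"
  by (induction n arbitrary: j) (auto intro!: sum_nonneg simp: p_nonneg)

text \<open>The decreasing limit \<open>u\<close> satisfies
  \<open>u j \<le> (\<Sum>i\<in>UNIV. p i j * u i)\<close>, and iterating this bounds
  \<open>u\<close> by its \<open>q\<close>-mean \<open>W\<close>. Averaging the fixed-point equation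
  against \<open>q\<close> loses the mass of \<open>S\<close>, so \<open>W\<close> is at most
  \<open>1 - (\<Sum>i\<in>S. q i)\<close> times itself, and that factor is below 1.\<close>

lemma avoid_limit:
  assumes "S \<noteq> {}"
  shows "(\<lambda>n. avoid S n j) \<longlonglongrightarrow> 0"
proof -
  have step: "avoid S (Suc n) j \<le> avoid S n j" for n j
  proof (induction n arbitrary: j)
    case 0
    have "(\<Sum>i\<in>-S. p i j) \<le> (\<Sum>i\<in>UNIV. p i j)" by (rule sum_mono2) (auto simp: p_nonneg)
    then show ?case by (simp add: p_sum)
  next
    case (Suc n)
    then show ?case unfolding avoid.simps(2)[of S "Suc n"] avoid.simps(2)[of S n]
      by (intro sum_mono mult_left_mono p_nonneg)
  qed
  have "\<exists>L. (\<lambda>n. avoid S n j) \<longlonglongrightarrow> L" for j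
    using decseq_convergent[OF decseq_SucI[of "\<lambda>n. avoid S n j", OF step], of 0] avoid_nonneg by metis
  then obtain u where u: "\<And>j. (\<lambda>n. avoid S n j) \<longlonglongrightarrow> u j" by metis
  have u_nonneg: "0 \<le> u j" for j by (rule LIMSEQ_le_const[OF u]) (auto simp: avoid_nonneg)
  have u_eq: "u j = (\<Sum>i\<in>-S. p i j * u i)" for j
  proof (rule LIMSEQ_unique)
    show "(\<lambda>n. avoid S (Suc n) j) \<longlonglongrightarrow> u j" by (rule LIMSEQ_Suc[OF u])
    show "(\<lambda>n. avoid S (Suc n) j) \<longlonglongrightarrow> (\<Sum>i\<in>-S. p i j * u i)"
      unfolding avoid.simps by (intro tendsto_intros u)
  qed
  define W where "W = (\<Sum>i\<in>UNIV. q i * u i)"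
  have "u j \<le> (\<Sum>i\<in>UNIV. ppow p n i j * u i)" for n j
  proof (induction n)
    case 0
    have "(if i = j then 1 else 0) * u i = (if i = j then u i else 0)" for i by simp
    then show ?case by simp
  next
    case (Suc n)
    have "u l \<le> (\<Sum>i\<in>UNIV. p i l * u i)" for l
      by (subst u_eq) (rule sum_mono2, auto simp: p_nonneg u_nonneg)
    then have "(\<Sum>l\<in>UNIV. ppow p n l j * u l) \<le> (\<Sum>l\<in>UNIV. ppow p n l j * (\<Sum>i\<in>UNIV. p i l * u i))"
      by (intro sum_mono mult_left_mono ppow_nonneg)
    also have "\<dots> = (\<Sum>l\<in>UNIV. \<Sum>i\<in>UNIV. p i l * ppow p n l j * u i)"
      by (simp add: sum_distrib_left mult_ac)
    also have "\<dots> = (\<Sum>i\<in>UNIV. \<Sum>l\<in>UNIV. p i l * ppow p n l j * u i)" by (rule sum.swap)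
    also have "\<dots> = (\<Sum>i\<in>UNIV. ppow p (Suc n) i j * u i)" by (simp add: sum_distrib_right)
    finally show ?case using Suc by simp
  qed
  moreover have "(\<lambda>n. \<Sum>i\<in>UNIV. ppow p n i j * u i) \<longlonglongrightarrow> W" for j
    unfolding W_def by (intro tendsto_intros ppow_limit)
  ultimately have u_le: "u j \<le> W" for j by (meson LIMSEQ_le_const)
  have "W = (\<Sum>j\<in>UNIV. \<Sum>i\<in>-S. p i j * q j * u i)"
    unfolding W_def by (subst u_eq) (simp add: sum_distrib_left mult_ac)
  also have "\<dots> = (\<Sum>i\<in>-S. \<Sum>j\<in>UNIV. p i j * q j * u i)" by (rule sum.swap)
  also have "\<dots> = (\<Sum>i\<in>-S. q i * u i)" by (simp add: sum_distrib_right[symmetric] q_inv)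
  also have "\<dots> \<le> (\<Sum>i\<in>-S. q i * W)" by (intro sum_mono mult_left_mono u_le q_nonneg)
  also have "\<dots> = (1 - (\<Sum>i\<in>S. q i)) * W"
    using sum.subset_diff[of S UNIV q] q_sum by (simp add: sum_distrib_right[symmetric] Compl_eq_Diff_UNIV)
  finally have "(\<Sum>i\<in>S. q i) * W \<le> 0" by (simp add: algebra_simps)
  moreover have "(\<Sum>i\<in>S. q i) > 0" using assms by (intro sum_pos) (auto simp: q_pos)
  ultimately have "W \<le> 0" by (simp add: mult_le_0_iff)
  then have "u j = 0" using u_le[of j] u_nonneg[of j] by linarith
  then show ?thesis using u[of j] by simp
qed

end

section \<open>Cylinder sets\<close>

text \<open>Windows with conflicting words are disjoint, so the empty set is added to get closure
  under intersection.\<close>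

definition windows :: "(nat \<Rightarrow> 'i set) \<Rightarrow> ('i \<Rightarrow> 'b) set set" where
  "windows J = insert {} {{x. \<forall>l\<in>J n. x l = w l} | n w. True}"

text \<open>One interface for two index sets: integers for the shift and naturals for its one-sided
  past.\<close>

locale window_family =
  fixes J :: "nat \<Rightarrow> 'i set"
  assumes J_finite: "finite (J n)" and J_mono: "mono J" and J_cover: "(\<Union>n. J n) = UNIV"
begin

abbreviation seqs :: "('i \<Rightarrow> 'b::finite) measure" where
  "seqs \<equiv> PiM UNIV (\<lambda>_. count_space UNIV)"

text \<open>The index sets are nested, so of two windows the longer one either refines the shorter
  one or contradicts it.\<close>

lemma Int_stable_windows: "Int_stable (windows J :: ('i \<Rightarrow> 'b) set set)"
proof (rule Int_stableI)
  have *: "{x. \<forall>l\<in>J n. x l = w l} \<inter> {x. \<forall>l\<in>J m. x l = w' l} \<in> windows J"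
    if "n \<le> m" for n m and w w' :: "'i \<Rightarrow> 'b"
  proof (cases "\<forall>l\<in>J n. w' l = w l")
    case True
    then have "{x. \<forall>l\<in>J n. x l = w l} \<inter> {x. \<forall>l\<in>J m. x l = w' l} = {x. \<forall>l\<in>J m. x l = w' l}"
      using monoD[OF J_mono that] by auto
    then show ?thesis unfolding windows_def by blast
  next
    case False
    then have "{x. \<forall>l\<in>J n. x l = w l} \<inter> {x. \<forall>l\<in>J m. x l = w' l} = {}"
      using monoD[OF J_mono that] by fastforce
    then show ?thesis by (simp add: windows_def)
  qed
  fix a b :: "('i \<Rightarrow> 'b) set" assume "a \<in> windows J" "b \<in> windows J"
  then consider "a = {} \<or> b = {}"
    | n m w w' where "a = {x. \<forall>l\<in>J n. x l = w l}" "b = {x. \<forall>l\<in>J m. x l = w' l}"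
    unfolding windows_def by auto
  then show "a \<inter> b \<in> windows J"
  proof cases
    case 1
    then show ?thesis by (auto simp: windows_def)
  next
    case (2 n m w w')
    then show ?thesis using *[of n m w w'] *[of m n w' w] by (cases "n \<le> m") (auto simp: Int_commute)
  qed
qed

lemma finite_windows_at:
  "finite {{x :: 'i \<Rightarrow> 'b::finite. \<forall>l\<in>J n. x l = w l} | w. True}"
proof (rule finite_subset)
  show "{{x :: 'i \<Rightarrow> 'b. \<forall>l\<in>J n. x l = w l} | w. True}
      \<subseteq> (\<lambda>w. {x. \<forall>l\<in>J n. x l = w l}) ` (PiE (J n) (\<lambda>_. UNIV))"
  proof safe
    fix w :: "'i \<Rightarrow> 'b"
    have "{x. \<forall>l\<in>J n. x l = w l} = {x. \<forall>l\<in>J n. x l = restrict w (J n) l}" by auto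
    then show "{x. \<forall>l\<in>J n. x l = w l} \<in> (\<lambda>w. {x. \<forall>l\<in>J n. x l = w l}) ` (PiE (J n) (\<lambda>_. UNIV))"
      by (intro image_eqI[of _ _ "restrict w (J n)"]) auto
  qed
  show "finite ((\<lambda>w. {x. \<forall>l\<in>J n. x l = w l}) ` (PiE (J n) (\<lambda>_. UNIV :: 'b set)))"
    by (intro finite_imageI finite_PiE J_finite) auto
qed

text \<open>Index sets and alphabet are finite, so an event about one coordinate is a finite union
  of windows.\<close>

lemma sets_windows: "sets (seqs :: ('i \<Rightarrow> 'b::finite) measure) = sigma_sets UNIV (windows J)"
proof
  have sp: "(\<Pi>\<^sub>E i\<in>UNIV. space (count_space UNIV)) = (UNIV :: ('i \<Rightarrow> 'b) set)" by (auto simp: PiE_UNIV_domain)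
  interpret S: sigma_algebra UNIV "sigma_sets UNIV (windows J :: ('i \<Rightarrow> 'b) set set)"
    by (rule sigma_algebra_sigma_sets) auto
  show "sets (seqs :: ('i \<Rightarrow> 'b) measure) \<subseteq> sigma_sets UNIV (windows J)"
    unfolding sets_PiM_single sp
  proof (rule S.sigma_sets_subset, safe)
    fix i :: 'i and A :: "'b set"
    obtain n where n: "i \<in> J n" using J_cover by blast
    have "{f. f i \<in> A} = \<Union>{{x. \<forall>l\<in>J n. x l = w l} | w. w i \<in> A}" using n by auto
    moreover have "\<Union>{{x. \<forall>l\<in>J n. x l = w l} | w. w i \<in> A} \<in> sigma_sets UNIV (windows J)"
      by (rule S.finite_Union) (auto simp: windows_def intro!: finite_subset[OF _ finite_windows_at[of n]] sigma_sets.Basic)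
    ultimately show "{f \<in> UNIV. f i \<in> A} \<in> sigma_sets UNIV (windows J)" by simp
  qed
  show "sigma_sets UNIV (windows J) \<subseteq> sets (seqs :: ('i \<Rightarrow> 'b) measure)"
  proof (rule sets.sigma_sets_subset'[where M = "seqs", unfolded space_PiM, simplified sp])
    show "UNIV \<in> sets (seqs :: ('i \<Rightarrow> 'b) measure)"
      using sets.top[of "seqs :: ('i \<Rightarrow> 'b) measure"] by (simp add: space_PiM sp)
    show "windows J \<subseteq> sets (seqs :: ('i \<Rightarrow> 'b) measure)"
    proof
      fix E :: "('i \<Rightarrow> 'b) set" assume "E \<in> windows J"
      then consider "E = {}" | n w where "E = {x. \<forall>l\<in>J n. x l = w l}" by (auto simp: windows_def)
      then show "E \<in> sets seqs"
      proof cases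
        case (2 n w)
        have [measurable]: "(\<lambda>x :: 'i \<Rightarrow> 'b. x l) \<in> seqs \<rightarrow>\<^sub>M count_space UNIV" for l
          by (rule measurable_component_singleton) simp
        have "{x \<in> space seqs. \<forall>l\<in>J n. x l = w l} \<in> sets seqs"
          using J_finite by measurable
        then show ?thesis using 2 by (simp add: space_PiM sp)
      qed simp
    qed
  qed
qed

text \<open>The pi-lambda argument, with the windows over \<open>J 0\<close> as countable cover of
  finite mass. Total mass 1 is not assumed, because the densities in \<open>markov_property\<close>
  are compared this way.\<close>

lemma measure_eqI_windows:
  assumes "sets M = sets (seqs :: ('i \<Rightarrow> 'b::finite) measure)" "sets N = sets (seqs :: ('i \<Rightarrow> 'b) measure)"
    and eq: "\<And>n w. emeasure M {x. \<forall>l\<in>J n. x l = w l} = emeasure N {x. \<forall>l\<in>J n. x l = w l}"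
    and fin: "\<And>n w. emeasure M {x. \<forall>l\<in>J n. x l = w l} \<noteq> \<infinity>"
  shows "M = N"
proof (rule measure_eqI_generator_eq_countable[OF Int_stable_windows])
  show "\<Union>{{x :: 'i \<Rightarrow> 'b. \<forall>l\<in>J 0. x l = w l} | w. True} = UNIV" by blast
  show "countable {{x :: 'i \<Rightarrow> 'b. \<forall>l\<in>J 0. x l = w l} | w. True}"
    by (rule countable_finite[OF finite_windows_at])
  show "{{x :: 'i \<Rightarrow> 'b. \<forall>l\<in>J 0. x l = w l} | w. True} \<subseteq> windows J"
    unfolding windows_def by blast
qed (use assms sets_windows in \<open>auto simp: windows_def\<close>)

text \<open>Convergence passes to disjoint unions by Tannery's theorem, since
  \<open>measure M\<close> dominates every \<open>\<phi> n\<close>. In the application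
  \<open>\<phi> n\<close> measures the intersection of a shifted event with another event, one of
  the two being held fixed.\<close>

lemma limit_extends_from_windows:
  fixes \<phi> :: "nat \<Rightarrow> ('i \<Rightarrow> 'b::finite) set \<Rightarrow> real"
  assumes "prob_space M" and M: "sets M = sets (seqs :: ('i \<Rightarrow> 'b) measure)"
    and \<phi>_bound: "\<And>n E. E \<in> sets M \<Longrightarrow> 0 \<le> \<phi> n E \<and> \<phi> n E \<le> measure M E"
    and \<phi>_sums: "\<And>n A. range A \<subseteq> sets M \<Longrightarrow> disjoint_family A \<Longrightarrow> (\<lambda>i. \<phi> n (A i)) sums \<phi> n (\<Union>i. A i)"
    and top: "\<And>n. \<phi> n UNIV = c"
    and windows: "\<And>m w. (\<lambda>n. \<phi> n {x. \<forall>l\<in>J m. x l = w l}) \<longlonglongrightarrow> c * measure M {x. \<forall>l\<in>J m. x l = w l}"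
    and E: "E \<in> sets M"
  shows "(\<lambda>n. \<phi> n E) \<longlonglongrightarrow> c * measure M E"
proof -
  interpret prob_space M by fact
  have space: "space M = UNIV" using sets_eq_imp_space_eq[OF M] by (simp add: space_PiM PiE_UNIV_domain)
  have gen: "sets M = sigma_sets UNIV (windows J)" using M sets_windows by simp
  have \<phi>_empty: "\<phi> n {} = 0" for n using \<phi>_bound[of "{}" n] by simp
  have "windows J \<subseteq> Pow UNIV" by simp
  from Int_stable_windows this E[unfolded gen] show ?thesis
  proof (induction rule: sigma_sets_induct_disjoint)
    case (basic A)
    then show ?case using windows by (auto simp: windows_def \<phi>_empty)
  next
    case empty
    then show ?case by (simp add: \<phi>_empty)
  next
    case (compl A)
    then have A: "A \<in> sets M" using gen by simp
    have "\<phi> n (UNIV - A) = c - \<phi> n A" for n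
    proof -
      \<comment> \<open>Finite additivity is extracted from the countable form by padding with empty
        sets.\<close>
      define B where "B i = (if i = 0 then A else if i = 1 then UNIV - A else {})" for i :: nat
      have "range B \<subseteq> sets M" using A sets.compl_sets[OF A] by (auto simp: B_def space)
      moreover have "disjoint_family B" by (auto simp: disjoint_family_on_def B_def)
      moreover have "(\<Union>i. B i) = UNIV"
      proof -
        have "B 0 \<union> B 1 = UNIV" by (auto simp: B_def)
        then show ?thesis by blast
      qed
      ultimately have "(\<lambda>i. \<phi> n (B i)) sums c" using \<phi>_sums[of B n] top by simp
      moreover have "(\<lambda>i. \<phi> n (B i)) sums (\<Sum>i\<in>{0,1}. \<phi> n (B i))"
        by (rule sums_finite) (auto simp: B_def \<phi>_empty)
      ultimately have "c = \<phi> n A + \<phi> n (UNIV - A)" using sums_unique2 by (fastforce simp: B_def)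
      then show ?thesis by simp
    qed
    moreover have "c * measure M (UNIV - A) = c - c * measure M A"
      using prob_compl[OF A] by (simp add: space right_diff_distrib)
    ultimately show ?case using compl by (auto intro!: tendsto_intros)
  next
    case (union A)
    then have A: "range A \<subseteq> sets M" using gen by simp
    have "(\<lambda>n. \<Sum>i. \<phi> n (A i)) \<longlonglongrightarrow> (\<Sum>i. c * measure M (A i))"
    proof (rule tannerys_theorem[where M = "\<lambda>i. measure M (A i)", THEN conjunct2, THEN conjunct2])
      show "summable (\<lambda>i. measure M (A i))"
        using finite_measure_UNION[OF A union(1)] by (rule sums_summable)
      show "\<forall>\<^sub>F (k, n) in sequentially \<times>\<^sub>F sequentially. norm (\<phi> n (A k)) \<le> measure M (A k)"
        using \<phi>_bound A by (intro always_eventually) auto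
    qed (use union in auto)
    moreover have "(\<Sum>i. \<phi> n (A i)) = \<phi> n (\<Union>i. A i)" for n
      using \<phi>_sums[OF A union(1), of n] by (simp add: sums_iff)
    moreover have "(\<Sum>i. c * measure M (A i)) = c * measure M (\<Union>i. A i)"
      using sums_mult[OF finite_measure_UNION[OF A union(1)], of c] by (simp add: sums_iff)
    ultimately show ?case by simp
  qed
qed

end

text \<open>Written as a start and a length so that it matches the cylinders in
  \<open>markov_measure\<close>.\<close>

definition int_window :: "nat \<Rightarrow> int set" where
  "int_window n = {- int n..- int n + int (2 * n)}"

interpretation int_windows: window_family int_window
proof
  show "mono int_window" by (auto simp: mono_def int_window_def)
  have "i \<in> int_window (nat \<bar>i\<bar>)" for i by (auto simp: int_window_def)
  then show "(\<Union>n. int_window n) = UNIV" by blast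
qed (simp add: int_window_def)

interpretation nat_windows: window_family "\<lambda>n::nat. {..n}"
  by standard (auto simp: mono_def)

section \<open>The Markov shift\<close>

definition shift :: "(int \<Rightarrow> 'a) \<Rightarrow> int \<Rightarrow> 'a" where
  "shift \<omega> = (\<lambda>i. \<omega> (i + 1))"

lemma shift_funpow: "(shift ^^ n) \<omega> = (\<lambda>i. \<omega> (i + int n))"
  by (induction n) (auto simp: shift_def algebra_simps)

text \<open>Time runs backwards, so that reading a new letter prepends it, as in
  \<open>past_shift\<close>.\<close>

definition past :: "(int \<Rightarrow> 'a) \<Rightarrow> nat \<Rightarrow> 'a" where
  "past \<omega> = (\<lambda>n. \<omega> (- int n))"

lemma past_shift: "past (shift \<omega>) = case_nat (\<omega> 1) (past \<omega>)"
  by (auto simp: past_def shift_def fun_eq_iff split: nat.split)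

definition cyl :: "int \<Rightarrow> nat \<Rightarrow> (int \<Rightarrow> 'a) \<Rightarrow> (int \<Rightarrow> 'a) set" where
  "cyl m n w = {\<omega>. \<forall>l\<in>{m..m + int n}. \<omega> l = w l}"

lemma int_window_eq_cyl: "{\<omega>. \<forall>l\<in>int_window n. \<omega> l = w l} = cyl (- int n) (2 * n) w"
  by (simp add: cyl_def int_window_def)

lemma vimage_shift_cyl: "(shift ^^ k) -` cyl m n w = cyl (m + int k) n (\<lambda>i. w (i - int k))"
proof -
  have "(\<forall>l\<in>{m..m + int n}. \<omega> (l + int k) = w l)
      \<longleftrightarrow> (\<forall>l\<in>{m + int k..m + int k + int n}. \<omega> l = w (l - int k))" for \<omega>
  proof safe
    fix l assume *: "\<forall>l\<in>{m..m + int n}. \<omega> (l + int k) = w l" "l \<in> {m + int k..m + int k + int n}"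
    then have "l - int k \<in> {m..m + int n}" by auto
    then show "\<omega> l = w (l - int k)" using * by force
  next
    fix l assume *: "\<forall>l\<in>{m + int k..m + int k + int n}. \<omega> l = w (l - int k)" "l \<in> {m..m + int n}"
    then have "l + int k \<in> {m + int k..m + int k + int n}" by auto
    then show "\<omega> (l + int k) = w l" using * by force
  qed
  then show ?thesis by (auto simp: cyl_def shift_funpow)
qed

lemma cyl_add: "cyl m (n + k) w = cyl m n w \<inter> cyl (m + int n) k w"
proof -
  have "{m..m + int (n + k)} = {m..m + int n} \<union> {m + int n..m + int n + int k}" by auto
  then show ?thesis unfolding cyl_def by auto
qed

lemma cyl_cong: "(\<And>l. m \<le> l \<Longrightarrow> l \<le> m + int n \<Longrightarrow> w l = w' l) \<Longrightarrow> cyl m n w = cyl m n w'"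
  by (auto simp: cyl_def)

lemma cyl_Suc: "cyl m (Suc n) (w(m := i)) = {\<omega>. \<omega> m = i} \<inter> cyl (m + 1) n w"
proof -
  have "{m..m + int (Suc n)} = insert m {m + 1..m + 1 + int n}" by auto
  then show ?thesis unfolding cyl_def by auto
qed

locale markov_shift = primitive_chain p q for p :: "'a::finite \<Rightarrow> 'a \<Rightarrow> real" and q +
  fixes \<mu> :: "(int \<Rightarrow> 'a) measure"
  assumes mu: "markov_measure p q \<mu>"
begin

sublocale prob_space \<mu> using mu by (simp add: markov_measure_def)

lemma sets_mu [measurable_cong]: "sets \<mu> = sets (PiM UNIV (\<lambda>_. count_space UNIV))"
  using mu by (simp add: markov_measure_def seqspace_def)

lemma space_mu [simp]: "space \<mu> = UNIV"
  using sets_eq_imp_space_eq[OF sets_mu] by (simp add: space_PiM PiE_UNIV_domain)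

lemma measurable_coord [measurable]: "(\<lambda>\<omega>. \<omega> l) \<in> \<mu> \<rightarrow>\<^sub>M count_space UNIV"
  by (subst measurable_cong_sets[OF sets_mu refl]) (rule measurable_component_singleton, simp)

lemma measurable_into_mu:
  assumes "\<And>l. (\<lambda>x. f x l) \<in> N \<rightarrow>\<^sub>M count_space UNIV"
  shows "f \<in> N \<rightarrow>\<^sub>M \<mu>"
  by (subst measurable_cong_sets[OF refl sets_mu]) (rule measurable_PiM_single', auto simp: assms)

lemma measurable_shift [measurable]: "shift \<in> \<mu> \<rightarrow>\<^sub>M \<mu>"
  by (rule measurable_into_mu) (simp add: shift_def)

lemma measurable_past [measurable]: "past \<in> \<mu> \<rightarrow>\<^sub>M PiM UNIV (\<lambda>_. count_space UNIV)"
  by (rule measurable_PiM_single') (auto simp: past_def)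

lemma cyl_sets [measurable, simp]: "cyl m n w \<in> sets \<mu>"
proof -
  have "{\<omega> \<in> space \<mu>. \<forall>l\<in>{m..m + int n}. \<omega> l = w l} \<in> sets \<mu>" by measurable
  then show ?thesis by (simp add: cyl_def)
qed

definition weight :: "int \<Rightarrow> nat \<Rightarrow> (int \<Rightarrow> 'a) \<Rightarrow> real" where
  "weight m n w = (\<Prod>l\<in>{m..<m + int n}. p (w (l + 1)) (w l))"

lemma prob_cyl: "prob (cyl m n w) = q (w m) * weight m n w"
  using mu by (simp add: markov_measure_def cyl_def weight_def)

lemma weight_cong: "(\<And>l. m \<le> l \<Longrightarrow> l \<le> m + int n \<Longrightarrow> w l = w' l) \<Longrightarrow> weight m n w = weight m n w'"
  unfolding weight_def by (rule prod.cong) auto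

lemma weight_add: "weight m (n + k) w = weight m n w * weight (m + int n) k w"
proof -
  have "{m..<m + int (n + k)} = {m..<m + int n} \<union> {m + int n..<m + int n + int k}" by auto
  then show ?thesis unfolding weight_def by (simp add: prod.union_disjoint)
qed

lemma weight_0 [simp]: "weight m 0 w = 1" and weight_1 [simp]: "weight m (Suc 0) w = p (w (m + 1)) (w m)"
proof -
  have "{m..<m + 1} = {m}" by auto
  then show "weight m 0 w = 1" "weight m (Suc 0) w = p (w (m + 1)) (w m)" by (simp_all add: weight_def)
qed

lemma weight_shift: "weight (m + k) n (\<lambda>i. w (i - k)) = weight m n w"
  unfolding weight_def
  by (rule prod.reindex_bij_witness[of _ "\<lambda>l. l + k" "\<lambda>l. l - k"]) (auto simp: algebra_simps)

text \<open>Chapman-Kolmogorov for two cylinders, the second starting \<open>k\<close> steps after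
  the first ends. Summing over the letter just before the second cylinder lengthens it to the left
  and shortens the gap. At \<open>k = 0\<close> both words prescribe the same position, and the
  identity matrix \<open>ppow p 0\<close> tests whether they agree there.\<close>

lemma prob_cyl_gap:
  "prob (cyl m n w \<inter> cyl (m + int n + int k) n' w')
    = q (w m) * weight m n w * ppow p k (w' (m + int n + int k)) (w (m + int n))
      * weight (m + int n + int k) n' w'"
proof (induction k arbitrary: n' w')
  case 0
  show ?case
  proof (cases "w' (m + int n) = w (m + int n)")
    case True
    \<comment> \<open>The words overlap in one position where they agree, so they glue to a single
      word.\<close>
    define v where "v l = (if l \<le> m + int n then w l else w' l)" for l
    have v1: "v l = w l" if "l \<le> m + int n" for l using that by (simp add: v_def)
    have v2: "v l = w' l" if "m + int n \<le> l" for l using that True by (auto simp: v_def)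
    have "cyl m (n + n') v = cyl m n w \<inter> cyl (m + int n) n' w'"
      unfolding cyl_add using cyl_cong[of m n v w] cyl_cong[of "m + int n" n' v w'] v1 v2 by simp
    moreover have "prob (cyl m (n + n') v) = q (w m) * (weight m n w * weight (m + int n) n' w')"
      unfolding prob_cyl weight_add
      using weight_cong[of m n v w] weight_cong[of "m + int n" n' v w'] v1 v2 by simp
    ultimately show ?thesis using True by simp
  next
    case False
    have "\<omega> (m + int n) = w (m + int n)" if "\<omega> \<in> cyl m n w" for \<omega>
      using that by (simp add: cyl_def)
    moreover have "\<omega> (m + int n) = w' (m + int n)" if "\<omega> \<in> cyl (m + int n) n' w'" for \<omega>
      using that by (simp add: cyl_def)
    ultimately have "cyl m n w \<inter> cyl (m + int n) n' w' = {}" using False by fastforce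
    then show ?thesis using False by simp
  qed
next
  case (Suc k)
  let ?l = "m + int n + int k"
  let ?w = "\<lambda>i. w'(?l := i)"
  have split: "cyl (?l + 1) n' w' = (\<Union>i. cyl ?l (Suc n') (?w i))"
    unfolding cyl_Suc by auto
  have wt: "weight ?l (Suc n') (?w i) = p (w' (?l + 1)) i * weight (?l + 1) n' w'" for i
  proof -
    have "weight (?l + 1) n' (?w i) = weight (?l + 1) n' w'" by (rule weight_cong) auto
    moreover have "weight ?l (Suc n') (?w i) = weight ?l (Suc 0) (?w i) * weight (?l + 1) n' (?w i)"
      using weight_add[of ?l "Suc 0" n' "?w i"] by (simp only: add_Suc add_0 of_nat_Suc of_nat_0 add_0_right add_0_left)
    ultimately show ?thesis by (simp only: weight_1) simp
  qed
  have "prob (cyl m n w \<inter> cyl (?l + 1) n' w') = prob (\<Union>i\<in>UNIV. cyl m n w \<inter> cyl ?l (Suc n') (?w i))"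
    unfolding split by (simp only: Int_UN_distrib)
  also have "\<dots> = (\<Sum>i\<in>UNIV. prob (cyl m n w \<inter> cyl ?l (Suc n') (?w i)))"
    by (rule finite_measure_finite_Union) (auto simp: disjoint_family_on_def cyl_Suc simp del: cyl_sets intro: cyl_sets)
  also have "\<dots> = (\<Sum>i\<in>UNIV. q (w m) * weight m n w * weight (?l + 1) n' w'
      * (p (w' (?l + 1)) i * ppow p k i (w (m + int n))))"
    unfolding Suc.IH wt by (simp only: fun_upd_same mult_ac)
  also have "\<dots> = q (w m) * weight m n w * weight (?l + 1) n' w' * ppow p (Suc k) (w' (?l + 1)) (w (m + int n))"
    by (simp only: sum_distrib_left ppow.simps)
  finally have main: "prob (cyl m n w \<inter> cyl (?l + 1) n' w')
    = q (w m) * weight m n w * weight (?l + 1) n' w' * ppow p (Suc k) (w' (?l + 1)) (w (m + int n))" .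
  have "m + int n + int (Suc k) = ?l + 1" by simp
  then show ?case by (simp only: main mult_ac)
qed

lemma distr_shift: "distr \<mu> \<mu> shift = \<mu>"
proof (rule int_windows.measure_eqI_windows)
  fix n and w :: "int \<Rightarrow> 'a"
  have "shift -` cyl (- int n) (2 * n) w = cyl (- int n + 1) (2 * n) (\<lambda>i. w (i - 1))"
    using vimage_shift_cyl[of 1 "- int n" "2 * n" w] by simp
  then show "emeasure (distr \<mu> \<mu> shift) {\<omega>. \<forall>l\<in>int_window n. \<omega> l = w l} = emeasure \<mu> {\<omega>. \<forall>l\<in>int_window n. \<omega> l = w l}"
    unfolding int_window_eq_cyl
    using weight_shift[of "- int n" 1 "2 * n" w]
    by (subst emeasure_distr) (auto simp: emeasure_eq_measure prob_cyl)
  show "emeasure (distr \<mu> \<mu> shift) {\<omega>. \<forall>l\<in>int_window n. \<omega> l = w l} \<noteq> \<infinity>"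
    unfolding int_window_eq_cyl by (subst emeasure_distr) (auto simp: emeasure_eq_measure)
qed (auto simp: sets_mu)

section \<open>Mixing and zero-one laws for the shift\<close>

lemma measurable_shift_funpow [measurable]: "(shift ^^ n) \<in> \<mu> \<rightarrow>\<^sub>M \<mu>"
  by (rule measurable_into_mu) (simp add: shift_funpow)

lemma shift_funpow_sets [measurable, simp]: "E \<in> sets \<mu> \<Longrightarrow> (shift ^^ n) -` E \<in> sets \<mu>"
  using measurable_sets[OF measurable_shift_funpow, of E n] by simp

lemma prob_vimage_shift: "E \<in> sets \<mu> \<Longrightarrow> prob ((shift ^^ n) -` E) = prob E"
proof (induction n)
  case (Suc n)
  have "prob ((shift ^^ Suc n) -` E) = prob (shift -` ((shift ^^ n) -` E))"
    by (simp only: funpow_Suc_right vimage_comp)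
  also have "\<dots> = measure (distr \<mu> \<mu> shift) ((shift ^^ n) -` E)"
    by (subst measure_distr) (auto simp: Suc.prems)
  also have "\<dots> = prob E" unfolding distr_shift using Suc by simp
  finally show ?case .
qed simp

text \<open>Once shifted beyond the end of the other cylinder, the first one enters through
  \<open>prob_cyl_gap\<close>, whose power of \<open>p\<close> tends to \<open>q\<close>.\<close>

lemma mixing_cyl: "(\<lambda>n. prob ((shift ^^ n) -` cyl m k w \<inter> cyl m' k' w')) \<longlonglongrightarrow> prob (cyl m' k' w') * prob (cyl m k w)"
proof -
  \<comment> \<open>The offset is the delay after which the shifted cylinder no longer starts before
    the other one ends; \<open>nat\<close> truncates it to 0 if this holds from the outset.\<close>
  have "(\<lambda>r. prob ((shift ^^ (r + nat (m' + int k' - m))) -` cyl m k w \<inter> cyl m' k' w'))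
      \<longlonglongrightarrow> prob (cyl m' k' w') * prob (cyl m k w)"
  proof (cases "m' + int k' \<ge> m")
    case True
    have "prob ((shift ^^ (r + nat (m' + int k' - m))) -` cyl m k w \<inter> cyl m' k' w')
        = q (w' m') * weight m' k' w' * ppow p r (w m) (w' (m' + int k')) * weight m k w" for r
    proof -
      define d where "d = int (r + nat (m' + int k' - m))"
      have d: "m + d = m' + int k' + int r" using True by (simp add: d_def)
      have "prob ((shift ^^ (r + nat (m' + int k' - m))) -` cyl m k w \<inter> cyl m' k' w')
        = prob (cyl m' k' w' \<inter> cyl (m' + int k' + int r) k (\<lambda>i. w (i - d)))"
        unfolding vimage_shift_cyl d_def[symmetric] d by (simp add: Int_commute)
      also have "\<dots> = q (w' m') * weight m' k' w' * ppow p r (w m) (w' (m' + int k')) * weight m k w"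
        unfolding prob_cyl_gap unfolding d[symmetric] weight_shift by simp
      finally show ?thesis .
    qed
    moreover have "(\<lambda>r. q (w' m') * weight m' k' w' * ppow p r (w m) (w' (m' + int k')) * weight m k w)
        \<longlonglongrightarrow> q (w' m') * weight m' k' w' * q (w m) * weight m k w"
      by (intro tendsto_intros ppow_limit)
    ultimately show ?thesis by (simp add: prob_cyl mult_ac)
  next
    case False
    define s where "s = nat (m - m' - int k')"
    have "prob ((shift ^^ r) -` cyl m k w \<inter> cyl m' k' w')
        = q (w' m') * weight m' k' w' * ppow p (r + s) (w m) (w' (m' + int k')) * weight m k w" for r
    proof -
      have d: "m + int r = m' + int k' + int (r + s)" using False by (simp add: s_def)
      have "prob ((shift ^^ r) -` cyl m k w \<inter> cyl m' k' w')
        = prob (cyl m' k' w' \<inter> cyl (m' + int k' + int (r + s)) k (\<lambda>i. w (i - int r)))"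
        unfolding vimage_shift_cyl d by (simp add: Int_commute)
      also have "\<dots> = q (w' m') * weight m' k' w' * ppow p (r + s) (w m) (w' (m' + int k')) * weight m k w"
        unfolding prob_cyl_gap unfolding d[symmetric] weight_shift by simp
      finally show ?thesis .
    qed
    moreover have "(\<lambda>r. q (w' m') * weight m' k' w' * ppow p (r + s) (w m) (w' (m' + int k')) * weight m k w)
        \<longlonglongrightarrow> q (w' m') * weight m' k' w' * q (w m) * weight m k w"
      by (intro tendsto_intros LIMSEQ_ignore_initial_segment[OF ppow_limit])
    ultimately show ?thesis using False by (simp add: prob_cyl mult_ac)
  qed
  then show ?thesis by (rule LIMSEQ_offset)
qed

text \<open>Two passes of the extension principle: first \<open>E\<close> varies against a fixed
  cylinder, with shift invariance giving the domination, then \<open>F\<close> varies against the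
  fixed \<open>E\<close>.\<close>

lemma mixing:
  assumes E: "E \<in> sets \<mu>" and F: "F \<in> sets \<mu>"
  shows "(\<lambda>n. prob ((shift ^^ n) -` E \<inter> F)) \<longlonglongrightarrow> prob F * prob E"
proof -
  have sums_vimage: "(\<lambda>i. prob ((shift ^^ n) -` A i \<inter> F)) sums prob ((shift ^^ n) -` (\<Union>i. A i) \<inter> F)"
    if "range A \<subseteq> sets \<mu>" "disjoint_family A" "F \<in> sets \<mu>" for A :: "nat \<Rightarrow> _" and F n
  proof -
    have "(\<lambda>i. prob ((shift ^^ n) -` A i \<inter> F)) sums prob (\<Union>i. (shift ^^ n) -` A i \<inter> F)"
      using that by (intro finite_measure_UNION) (auto simp: disjoint_family_on_def)
    then show ?thesis by (simp add: vimage_Union)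
  qed
  have step1: "(\<lambda>n. prob ((shift ^^ n) -` E \<inter> cyl m k w)) \<longlonglongrightarrow> prob (cyl m k w) * prob E" for m k w
  proof (rule int_windows.limit_extends_from_windows[OF prob_space_axioms sets_mu])
    fix n G assume G: "G \<in> sets \<mu>"
    have "prob ((shift ^^ n) -` G \<inter> cyl m k w) \<le> prob ((shift ^^ n) -` G)"
      using G by (intro finite_measure_mono) auto
    then show "0 \<le> prob ((shift ^^ n) -` G \<inter> cyl m k w) \<and> prob ((shift ^^ n) -` G \<inter> cyl m k w) \<le> prob G"
      using G by (simp add: prob_vimage_shift)
  next
    show "(\<lambda>n. prob ((shift ^^ n) -` {x. \<forall>l\<in>int_window r. x l = v l} \<inter> cyl m k w))
        \<longlonglongrightarrow> prob (cyl m k w) * prob {x. \<forall>l\<in>int_window r. x l = v l}" for r v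
      unfolding int_window_eq_cyl by (rule mixing_cyl)
  qed (use E sums_vimage in auto)
  have "(\<lambda>n. prob ((shift ^^ n) -` E \<inter> F)) \<longlonglongrightarrow> prob E * prob F"
  proof (rule int_windows.limit_extends_from_windows[OF prob_space_axioms sets_mu])
    fix n G assume G: "G \<in> sets \<mu>"
    then show "0 \<le> prob ((shift ^^ n) -` E \<inter> G) \<and> prob ((shift ^^ n) -` E \<inter> G) \<le> prob G"
      by (auto intro: finite_measure_mono)
  next
    fix n :: nat and A :: "nat \<Rightarrow> _" assume A: "range A \<subseteq> sets \<mu>" "disjoint_family A"
    have "(\<lambda>i. prob ((shift ^^ n) -` E \<inter> A i)) sums prob (\<Union>i. (shift ^^ n) -` E \<inter> A i)"
      using A E by (intro finite_measure_UNION) (auto simp: disjoint_family_on_def)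
    then show "(\<lambda>i. prob ((shift ^^ n) -` E \<inter> A i)) sums prob ((shift ^^ n) -` E \<inter> (\<Union>i. A i))"
      by simp
  next
    show "(\<lambda>n. prob ((shift ^^ n) -` E \<inter> {x. \<forall>l\<in>int_window r. x l = v l}))
        \<longlonglongrightarrow> prob E * prob {x. \<forall>l\<in>int_window r. x l = v l}" for r v
      unfolding int_window_eq_cyl using step1 by (simp add: mult.commute)
    show "prob ((shift ^^ n) -` E \<inter> UNIV) = prob E" for n by (simp add: prob_vimage_shift[OF E])
  qed (use F in auto)
  then show ?thesis by (simp add: mult.commute)
qed

text \<open>Under this inclusion every shifted copy of \<open>E\<close> contains \<open>E\<close>,
  so mixing gives \<open>prob E = prob E * prob E\<close>. One inclusion is all that the visit
  events below satisfy surely.\<close>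

lemma zero_one_forward:
  assumes E: "E \<in> sets \<mu>" and sub: "E \<subseteq> shift -` E"
  shows "prob E = 0 \<or> prob E = 1"
proof -
  have "E \<subseteq> (shift ^^ n) -` E" for n
    using sub by (induction n) (auto simp: subset_iff)
  then have "(shift ^^ n) -` E \<inter> E = E" for n by blast
  then have "(\<lambda>n::nat. prob E) \<longlonglongrightarrow> prob E * prob E" using mixing[OF E E] by simp
  then have "prob E = prob E * prob E" using LIMSEQ_unique tendsto_const by blast
  then show ?thesis by simp
qed

lemma zero_one_backward:
  assumes E: "E \<in> sets \<mu>" and sub: "shift -` E \<subseteq> E"
  shows "prob E = 0 \<or> prob E = 1"
proof -
  have "UNIV - E \<in> sets \<mu>" using sets.compl_sets[OF E] by simp
  moreover have "UNIV - E \<subseteq> shift -` (UNIV - E)" using sub by blast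
  ultimately have "prob (UNIV - E) = 0 \<or> prob (UNIV - E) = 1" by (rule zero_one_forward)
  then show ?thesis using prob_compl[OF E] by auto
qed

sublocale ergodic_map \<mu> shift
proof
  fix E assume "E \<in> sets \<mu>" "shift -` E \<inter> space \<mu> = E"
  then show "prob E = 0 \<or> prob E = 1" by (intro zero_one_forward) auto
qed (rule measurable_shift, rule distr_shift)

lemma prob_coord: "prob {\<omega>. \<omega> l = i} = q i"
proof -
  have "{\<omega>. \<omega> l = i} = cyl l 0 (\<lambda>_. i)" by (auto simp: cyl_def)
  then show ?thesis by (simp add: prob_cyl)
qed

text \<open>Shifting keeps a visit in the past, but may lose the future visit at time 1; hence one
  zero-one law for each direction. Probability 0 is excluded because a single coordinate already
  equals \<open>s\<close> with probability \<open>q s > 0\<close>.\<close>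

lemma AE_visits_future: "AE \<omega> in \<mu>. \<exists>k\<ge>1. \<omega> (int k) = s"
    and AE_visits_past: "AE \<omega> in \<mu>. \<exists>k. past \<omega> k = s"
proof -
  have E: "{\<omega>. \<exists>k\<ge>1. \<omega> (int k) = s} \<in> sets \<mu>" (is "?E \<in> _")
  proof -
    have "{\<omega> \<in> space \<mu>. \<exists>k\<ge>1::nat. \<omega> (int k) = s} \<in> sets \<mu>" by measurable
    then show ?thesis by simp
  qed
  have "shift -` ?E \<subseteq> ?E"
  proof
    fix \<omega> assume "\<omega> \<in> shift -` ?E"
    then obtain k where "\<omega> (int k + 1) = s" by (auto simp: shift_def)
    then have "\<omega> (int (Suc k)) = s" by (simp add: add.commute)
    then show "\<omega> \<in> ?E" by (auto intro!: exI[of _ "Suc k"])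
  qed
  then have "prob ?E = 0 \<or> prob ?E = 1" using E by (rule zero_one_backward[rotated])
  moreover have "prob {\<omega>. \<omega> 1 = s} \<le> prob ?E"
    using E by (intro finite_measure_mono) (auto intro!: exI[of _ "1::nat"])
  ultimately have "prob ?E = 1" using prob_coord[of 1 s] q_pos[of s] by auto
  then show "AE \<omega> in \<mu>. \<exists>k\<ge>1. \<omega> (int k) = s" using prob_eq_1[OF E] by simp
  have F: "{\<omega>. \<exists>k. past \<omega> k = s} \<in> sets \<mu>" (is "?F \<in> _")
  proof -
    have "{\<omega> \<in> space \<mu>. \<exists>k. \<omega> (- int k) = s} \<in> sets \<mu>" by measurable
    then show ?thesis by (simp add: past_def)
  qed
  have "?F \<subseteq> shift -` ?F"
  proof
    fix \<omega> assume "\<omega> \<in> ?F"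
    then obtain k where "past \<omega> k = s" by blast
    then have "past (shift \<omega>) (Suc k) = s" by (simp add: past_shift)
    then show "\<omega> \<in> shift -` ?F" by blast
  qed
  then have "prob ?F = 0 \<or> prob ?F = 1" using F by (rule zero_one_forward[rotated])
  moreover have "prob {\<omega>. \<omega> 0 = s} \<le> prob ?F"
    using F by (intro finite_measure_mono) (auto simp: past_def intro!: exI[of _ "0::nat"])
  ultimately have "prob ?F = 1" using prob_coord[of 0 s] q_pos[of s] by auto
  then show "AE \<omega> in \<mu>. \<exists>k. past \<omega> k = s" using prob_eq_1[OF F] by simp
qed

section \<open>The Markov property given the whole past\<close>

lemma past_window: "past -` {x. \<forall>l\<in>{..n}. x l = w l} = cyl (- int n) n (\<lambda>i. w (nat (- i)))"
proof -
  have "(\<forall>l\<in>{..n}. \<omega> (- int l) = w l) \<longleftrightarrow> (\<forall>i\<in>{- int n..0}. \<omega> i = w (nat (- i)))" for \<omega>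
  proof safe
    fix i assume *: "\<forall>l\<in>{..n}. \<omega> (- int l) = w l" and "i \<in> {- int n..0}"
    then have "nat (- i) \<le> n" "- int (nat (- i)) = i" by auto
    then show "\<omega> i = w (nat (- i))" using * by (metis atMost_iff)
  qed auto
  then show ?thesis by (auto simp: cyl_def past_def)
qed

text \<open>Given the whole past, the next letter is \<open>i\<close> with probability
  \<open>p i (\<omega> 0)\<close>. Phrased as an equality of finite measures on one-sided sequences,
  it only has to be checked on windows.\<close>

lemma markov_property:
  "distr (density \<mu> (indicator {\<omega>. \<omega> 1 = i})) (PiM UNIV (\<lambda>_. count_space UNIV)) past
    = distr (density \<mu> (\<lambda>\<omega>. ennreal (p i (\<omega> 0)))) (PiM UNIV (\<lambda>_. count_space UNIV)) past"
  (is "?M = ?N")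
proof (rule nat_windows.measure_eqI_windows)
  have [measurable]: "{\<omega>. \<omega> 1 = i} \<in> sets \<mu>"
  proof -
    have "{\<omega> \<in> space \<mu>. \<omega> 1 = i} \<in> sets \<mu>" by measurable
    then show ?thesis by simp
  qed
  fix n and w :: "nat \<Rightarrow> 'a"
  define v where "v i = w (nat (- i))" for i
  let ?W = "{x. \<forall>l\<in>{..n}. x l = w l}"
  have W: "?W \<in> sets (PiM UNIV (\<lambda>_::nat. count_space (UNIV :: 'a set)))"
    unfolding nat_windows.sets_windows by (rule sigma_sets.Basic) (auto simp: windows_def)
  have pW: "past -` ?W = cyl (- int n) n v" unfolding past_window v_def ..
  have M: "emeasure ?M ?W = ennreal (q (v (- int n)) * weight (- int n) n v * p i (v 0))"
  proof -
    have "emeasure ?M ?W = emeasure (density \<mu> (indicator {\<omega>. \<omega> 1 = i})) (past -` ?W)"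
      using W by (subst emeasure_distr) (auto simp del: vimage_Collect_eq)
    also have "\<dots> = (\<integral>\<^sup>+ \<omega>. indicator {\<omega>. \<omega> 1 = i} \<omega> * indicator (cyl (- int n) n v) \<omega> \<partial>\<mu>)"
      unfolding pW by (subst emeasure_density) auto
    \<comment> \<open>The next letter is a cylinder of one position lying one step beyond the
      window, so \<open>prob_cyl_gap\<close> applies with gap 1.\<close>
    also have "\<dots> = (\<integral>\<^sup>+ \<omega>. indicator (cyl (- int n) n v \<inter> cyl (- int n + int n + int 1) 0 (\<lambda>_. i)) \<omega> \<partial>\<mu>)"
      by (rule nn_integral_cong) (auto simp: indicator_def cyl_def)
    also have "\<dots> = ennreal (q (v (- int n)) * weight (- int n) n v * p i (v 0))"
      by (subst nn_integral_indicator, simp)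
        (simp only: emeasure_eq_measure prob_cyl_gap, simp add: sum.If_cases if_distrib[of "(*) _"] cong: if_cong)
    finally show ?thesis .
  qed
  have N: "emeasure ?N ?W = ennreal (q (v (- int n)) * weight (- int n) n v * p i (v 0))"
  proof -
    have "emeasure ?N ?W = emeasure (density \<mu> (\<lambda>\<omega>. ennreal (p i (\<omega> 0)))) (past -` ?W)"
      using W by (subst emeasure_distr) (auto simp del: vimage_Collect_eq)
    also have "\<dots> = (\<integral>\<^sup>+ \<omega>. ennreal (p i (\<omega> 0)) * indicator (cyl (- int n) n v) \<omega> \<partial>\<mu>)"
      unfolding pW by (subst emeasure_density) auto
    also have "\<dots> = (\<integral>\<^sup>+ \<omega>. ennreal (p i (v 0)) * indicator (cyl (- int n) n v) \<omega> \<partial>\<mu>)"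
      by (rule nn_integral_cong) (auto simp: indicator_def cyl_def)
    also have "\<dots> = ennreal (p i (v 0)) * ennreal (prob (cyl (- int n) n v))"
      by (subst nn_integral_cmult_indicator) (auto simp: emeasure_eq_measure)
    also have "\<dots> = ennreal (q (v (- int n)) * weight (- int n) n v * p i (v 0))"
      by (simp add: ennreal_mult'[symmetric] p_nonneg prob_cyl mult_ac)
    finally show ?thesis .
  qed
  show "emeasure ?M ?W = emeasure ?N ?W" unfolding M N ..
  show "emeasure ?M ?W \<noteq> \<infinity>" unfolding M by simp
qed auto

text \<open>Integrates out the next letter. It yields both the operator \<open>Qop\<close> in the
  stationarity proof and the weighted sum in \<open>Psi\<close>; the nonnegative form admits
  infinite integrals.\<close>

lemma nn_integral_markov:
  assumes [measurable]: "\<And>i. h i \<in> borel_measurable (PiM UNIV (\<lambda>_. count_space UNIV))"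
  shows "(\<integral>\<^sup>+ \<omega>. h (\<omega> 1) (past \<omega>) \<partial>\<mu>) = (\<integral>\<^sup>+ \<omega>. (\<Sum>i\<in>UNIV. ennreal (p i (\<omega> 0)) * h i (past \<omega>)) \<partial>\<mu>)"
proof -
  have [measurable]: "{\<omega>. \<omega> 1 = i} \<in> sets \<mu>" for i
  proof -
    have "{\<omega> \<in> space \<mu>. \<omega> 1 = i} \<in> sets \<mu>" by measurable
    then show ?thesis by simp
  qed
  have [measurable]: "(\<lambda>\<omega>. h i (past \<omega>)) \<in> borel_measurable \<mu>" for i by measurable
  have "h (\<omega> 1) (past \<omega>) = (\<Sum>i\<in>UNIV. indicator {\<omega>. \<omega> 1 = i} \<omega> * h i (past \<omega>))" for \<omega>
  proof -
    have "indicator {\<omega>. \<omega> 1 = i} \<omega> * h i (past \<omega>) = (if \<omega> 1 = i then h i (past \<omega>) else 0)" for i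
      by (simp add: indicator_def)
    then show ?thesis by simp
  qed
  then have "(\<integral>\<^sup>+ \<omega>. h (\<omega> 1) (past \<omega>) \<partial>\<mu>) = (\<integral>\<^sup>+ \<omega>. (\<Sum>i\<in>UNIV. indicator {\<omega>. \<omega> 1 = i} \<omega> * h i (past \<omega>)) \<partial>\<mu>)"
    by (rule nn_integral_cong)
  also have "\<dots> = (\<Sum>i\<in>UNIV. \<integral>\<^sup>+ \<omega>. indicator {\<omega>. \<omega> 1 = i} \<omega> * h i (past \<omega>) \<partial>\<mu>)"
    by (rule nn_integral_sum) measurable
  also have "\<dots> = (\<Sum>i\<in>UNIV. \<integral>\<^sup>+ \<omega>. ennreal (p i (\<omega> 0)) * h i (past \<omega>) \<partial>\<mu>)"
  proof (rule sum.cong)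
    fix i
    have "(\<integral>\<^sup>+ \<omega>. indicator {\<omega>. \<omega> 1 = i} \<omega> * h i (past \<omega>) \<partial>\<mu>)
        = (\<integral>\<^sup>+ x. h i x \<partial>distr (density \<mu> (indicator {\<omega>. \<omega> 1 = i})) (PiM UNIV (\<lambda>_. count_space UNIV)) past)"
      by (simp add: nn_integral_distr nn_integral_density)
    also have "\<dots> = (\<integral>\<^sup>+ \<omega>. ennreal (p i (\<omega> 0)) * h i (past \<omega>) \<partial>\<mu>)"
      unfolding markov_property by (simp add: nn_integral_distr nn_integral_density)
    finally show "(\<integral>\<^sup>+ \<omega>. indicator {\<omega>. \<omega> 1 = i} \<omega> * h i (past \<omega>) \<partial>\<mu>) = (\<integral>\<^sup>+ \<omega>. ennreal (p i (\<omega> 0)) * h i (past \<omega>) \<partial>\<mu>)" .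
  qed simp
  also have "\<dots> = (\<integral>\<^sup>+ \<omega>. (\<Sum>i\<in>UNIV. ennreal (p i (\<omega> 0)) * h i (past \<omega>)) \<partial>\<mu>)"
    by (rule nn_integral_sum[symmetric]) measurable
  finally show ?thesis .
qed

end

section \<open>The projective line\<close>

abbreviation nonzero_borel :: "(real^2) measure" where
  "nonzero_borel \<equiv> restrict_space borel {v. v \<noteq> 0}"

lemma open_nonzero: "open {v :: real^2. v \<noteq> 0}"
  by (simp add: Collect_neg_eq open_closed)

text \<open>The family handed to \<open>measure_of\<close> is already a sigma-algebra, so generating
  adds nothing.\<close>

lemma sets_P1: "sets P1 = {S. S \<subseteq> lines \<and> {v. v \<noteq> 0 \<and> span {v} \<in> S} \<in> sets borel}" (is "_ = ?\<Sigma>")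
  and space_P1 [simp]: "space P1 = lines"
proof -
  have nz: "{v :: real^2. v \<noteq> 0} \<in> sets borel" using open_nonzero by (rule borel_open)
  have "sigma_algebra lines ?\<Sigma>"
    unfolding sigma_algebra_iff2
  proof (intro conjI ballI allI impI)
    fix S assume S: "S \<in> ?\<Sigma>"
    have "{v. v \<noteq> 0 \<and> span {v} \<in> lines - S} = {v. v \<noteq> 0} - {v. v \<noteq> 0 \<and> span {v} \<in> S}"
      by (auto simp: lines_def)
    also have "\<dots> \<in> sets borel" using S nz by blast
    finally show "lines - S \<in> ?\<Sigma>" by blast
  next
    fix B :: "nat \<Rightarrow> _" assume B: "range B \<subseteq> ?\<Sigma>"
    have "{v. v \<noteq> 0 \<and> span {v} \<in> (\<Union>i. B i)} = (\<Union>i. {v. v \<noteq> 0 \<and> span {v} \<in> B i})" by auto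
    also have "\<dots> \<in> sets borel" using B by (intro sets.countable_UN) auto
    finally show "(\<Union>i. B i) \<in> ?\<Sigma>" using B by blast
  qed auto
  then interpret sigma_algebra lines ?\<Sigma> .
  show "sets P1 = ?\<Sigma>" unfolding P1_def by (simp add: sets_measure_of_eq)
  show "space P1 = lines" unfolding P1_def by (simp add: space_measure_of_eq)
qed

text \<open>The universal property of the quotient: measurability is tested on nonzero
  vectors.\<close>

lemma measurable_P1I:
  assumes f: "(\<lambda>v. f (span {v})) \<in> nonzero_borel \<rightarrow>\<^sub>M X"
  shows "f \<in> P1 \<rightarrow>\<^sub>M X"
proof (rule measurableI)
  fix l assume "l \<in> space P1"
  then obtain v :: "real^2" where "v \<noteq> 0" "l = span {v}" by (auto simp: lines_def)
  then show "f l \<in> space X" using measurable_space[OF f, of v] by (simp add: space_restrict_space)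
next
  fix S assume "S \<in> sets X"
  from measurable_sets[OF f this]
  have "{v. v \<noteq> 0 \<and> f (span {v}) \<in> S} \<in> sets borel"
    using borel_open[OF open_nonzero]
    by (simp add: sets_restrict_space_iff space_restrict_space vimage_def Int_def conj_commute)
  moreover have "{v. v \<noteq> 0 \<and> span {v} \<in> f -` S \<inter> lines} = {v. v \<noteq> 0 \<and> f (span {v}) \<in> S}"
    by (auto simp: lines_def)
  ultimately show "f -` S \<inter> space P1 \<in> sets P1" by (simp add: sets_P1)
qed

lemma measurable_span: "(\<lambda>v. span {v}) \<in> nonzero_borel \<rightarrow>\<^sub>M P1"
proof (rule measurableI)
  show "span {v} \<in> space P1" if "v \<in> space nonzero_borel" for v
    using that by (auto simp: space_restrict_space lines_def)
next
  fix S assume "S \<in> sets P1"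
  then have "{v. v \<noteq> 0 \<and> span {v} \<in> S} \<in> sets borel" by (simp add: sets_P1)
  then show "(\<lambda>v. span {v}) -` S \<inter> space nonzero_borel \<in> sets nonzero_borel"
    using borel_open[OF open_nonzero]
    by (auto simp: sets_restrict_space_iff space_restrict_space vimage_def Int_def conj_commute)
qed

lemma lines_obtain_rep:
  assumes "l \<in> lines"
  shows "rep l \<in> l" "rep l \<noteq> 0" "l = span {rep l}"
proof -
  obtain v where v: "v \<noteq> 0" "l = span {v}" using assms by (auto simp: lines_def)
  then have "v \<in> l \<and> v \<noteq> 0" by (simp add: span_base)
  then have "rep l \<in> l \<and> rep l \<noteq> 0" unfolding rep_def by (rule someI)
  then show r: "rep l \<in> l" "rep l \<noteq> 0" by auto
  obtain c where c: "rep l = c *\<^sub>R v" using r(1) v(2) by (auto simp: span_singleton)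
  then have "c \<noteq> 0" using r(2) by auto
  then have "v = (1 / c) *\<^sub>R rep l" using c by simp
  then have "v \<in> span {rep l}" by (metis span_base span_scale singletonI)
  then have "span {v} \<subseteq> span {rep l}" by (simp add: span_minimal)
  moreover have "span {rep l} \<subseteq> span {v}" using r(1) v(2) by (simp add: span_minimal)
  ultimately show "l = span {rep l}" using v(2) by blast
qed

lemma rank_1_range_line:
  assumes "rank (M :: real^2^2) = 1"
  shows "range (\<lambda>x. M *v x) \<in> lines"
proof -
  let ?V = "range (\<lambda>x. M *v x)"
  have sub: "subspace ?V"
    by (metis linear_subspace_image matrix_vector_mul_linear subspace_UNIV)
  have "dim ?V = 1" using assms by (simp add: rank_dim_range)
  then obtain B where B: "B \<subseteq> ?V" "independent B" "?V \<subseteq> span B" "card B = 1"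
    using basis_exists[of ?V] by metis
  then obtain v where v: "B = {v}" by (meson card_1_singletonE)
  then have "v \<noteq> 0" using B(2) by (auto simp: dependent_zero)
  moreover have "?V = span {v}" using B v sub by (simp add: span_minimal subset_antisym)
  ultimately show ?thesis by (auto simp: lines_def)
qed

lemma rank_1_not_invertible:
  assumes "rank (M :: real^2^2) = 1"
  shows "\<not> invertible M"
proof
  assume "invertible M"
  then have "surj ((*v) M)" by (metis invertible_def matrix_right_invertible_surjective)
  then show False using assms by (simp flip: full_rank_surjective)
qed

lemma invertible_mult_nonzero:
  assumes "invertible (M :: real^2^2)" "v \<noteq> 0"
  shows "M *v v \<noteq> 0"
  using assms by (metis invertible_def matrix_left_invertible_ker)

lemma pact_singular: "rank M = 1 \<Longrightarrow> pact M l = range (\<lambda>x. M *v x)"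
  by (simp add: pact_def rank_1_not_invertible)

lemma pact_invertible: "invertible M \<Longrightarrow> pact M (span {v}) = span {M *v v}"
  by (simp add: pact_def linear_span_image[symmetric, OF matrix_vector_mul_linear])

lemma image_subset_pact: "(\<lambda>x. M *v x) ` l \<subseteq> pact M l"
  by (auto simp: pact_def)

lemma pact_lines:
  assumes "rank M = 1 \<or> invertible M" "l \<in> lines"
  shows "pact M l \<in> lines"
  using assms(1)
proof
  assume "invertible M"
  moreover obtain v where "v \<noteq> 0" "l = span {v}" using assms(2) by (auto simp: lines_def)
  ultimately show ?thesis using invertible_mult_nonzero[of M v] by (auto simp: pact_invertible lines_def)
qed (simp add: pact_singular rank_1_range_line)

lemma continuous_mult_vec: "continuous_on S (\<lambda>x. (M :: real^2^2) *v x)"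
  by (intro linear_continuous_on matrix_vector_mul_bounded_linear)

text \<open>A singular matrix acts by a constant; an invertible one lifts to a continuous map that
  preserves nonzero vectors.\<close>

lemma measurable_pact:
  assumes "rank M = 1 \<or> invertible M"
  shows "pact M \<in> P1 \<rightarrow>\<^sub>M P1"
  using assms
proof
  assume "rank M = 1"
  then have "pact M = (\<lambda>l. range (\<lambda>x. M *v x))" by (auto simp: pact_singular)
  then show ?thesis using rank_1_range_line[OF \<open>rank M = 1\<close>] by simp
next
  assume M: "invertible M"
  have "(\<lambda>v. M *v v) \<in> nonzero_borel \<rightarrow>\<^sub>M nonzero_borel"
  proof (rule measurable_restrict_space2)
    show "(\<lambda>v. M *v v) \<in> nonzero_borel \<rightarrow>\<^sub>M borel"
      by (rule borel_measurable_continuous_on_restrict[OF continuous_mult_vec])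
  qed (use invertible_mult_nonzero[OF M] in \<open>auto simp: space_restrict_space\<close>)
  from measurable_compose[OF this measurable_span] show ?thesis
    by (intro measurable_P1I) (simp add: pact_invertible[OF M])
qed

definition stretch :: "mat2 \<Rightarrow> (real^2) set \<Rightarrow> real" where
  "stretch M l = norm (M *v rep l) / norm (rep l)"

lemma stretch_nonneg: "0 \<le> stretch M l"
  by (simp add: stretch_def)

text \<open>By linearity all vectors of a line are stretched alike, so the arbitrary choice in
  \<open>rep\<close> is harmless.\<close>

lemma norm_mult_line:
  assumes "l \<in> lines" "x \<in> l"
  shows "norm (M *v x) = stretch M l * norm x"
proof -
  note r = lines_obtain_rep[OF assms(1)]
  obtain c where "x = c *\<^sub>R rep l" using assms(2) r(3) by (auto simp: span_singleton)
  then show ?thesis using r(2) by (simp add: stretch_def matrix_vector_mult_scaleR)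
qed

lemma mnorm_nonneg: "0 \<le> mnorm M"
  unfolding mnorm_def by (rule onorm_pos_le) (rule matrix_vector_mul_bounded_linear)

lemma stretch_le_mnorm: "stretch M l \<le> mnorm M"
proof -
  have "norm (M *v rep l) \<le> mnorm M * norm (rep l)"
    unfolding mnorm_def by (rule onorm) (rule matrix_vector_mul_bounded_linear)
  moreover have "0 \<le> mnorm M" by (rule mnorm_nonneg)
  ultimately show ?thesis unfolding stretch_def by (cases "rep l = 0") (auto simp: field_simps)
qed

text \<open>The choice function \<open>rep\<close> offers no measurability; on
  \<open>span {v}\<close> it is replaced by \<open>v\<close>, which leaves a continuous
  quotient.\<close>

lemma measurable_stretch [measurable]: "stretch M \<in> borel_measurable P1"
proof (rule measurable_P1I)
  have "stretch M (span {v}) = norm (M *v v) / norm v" if "v \<noteq> 0" for v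
  proof -
    have "span {v} \<in> lines" using that by (auto simp: lines_def)
    then show ?thesis using that norm_mult_line[of "span {v}" v M] by (simp add: span_base)
  qed
  moreover have "(\<lambda>v. norm (M *v v) / norm v) \<in> borel_measurable nonzero_borel"
    by (intro borel_measurable_continuous_on_restrict continuous_intros continuous_mult_vec) auto
  ultimately show "(\<lambda>v. stretch M (span {v})) \<in> borel_measurable nonzero_borel"
    by (subst measurable_cong) (auto simp: space_restrict_space)
qed

lemma measurable_eln [measurable]: "eln \<in> borel_measurable borel"
  unfolding eln_def by measurable

lemma space_SP [simp]: "space SP = UNIV \<times> lines"
  by (simp add: SP_def space_pair_measure)

lemma measurable_SPI:
  fixes f :: "'a::finite \<times> (real^2) set \<Rightarrow> 'b"
  shows "(\<And>j. (\<lambda>l. f (j, l)) \<in> P1 \<rightarrow>\<^sub>M X) \<Longrightarrow> f \<in> SP \<rightarrow>\<^sub>M X"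
  unfolding SP_def by (rule measurable_pair_measure_countable1) (auto intro: countable_finite)

lemma measurable_SP_section: "f \<in> SP \<rightarrow>\<^sub>M X \<Longrightarrow> (\<lambda>l. f (j, l)) \<in> P1 \<rightarrow>\<^sub>M X"
  unfolding SP_def by (erule measurable_Pair2) simp

lemma Psi_eq: "Psi A p (j, l) = (\<Sum>i\<in>UNIV. ereal (p i j) * eln (stretch (A i) l))"
  by (simp add: Psi_def stretch_def)

lemma measurable_Psi [measurable]: "Psi A p \<in> borel_measurable SP"
  by (rule measurable_SPI) (simp add: Psi_eq)

lemma Qop_eq: "Qop A p \<phi> (j, l) = (\<Sum>i\<in>UNIV. \<phi> (i, pact (A i) l) * p i j)"
  by (simp add: Qop_def)

lemma measurable_Qop:
  assumes "\<And>i. rank (A i) = 1 \<or> invertible (A i)" "\<phi> \<in> borel_measurable SP"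
  shows "Qop A p \<phi> \<in> borel_measurable SP"
proof (rule measurable_SPI)
  fix j
  have "(\<lambda>l. \<phi> (i, pact (A i) l)) \<in> borel_measurable P1" for i
    using measurable_compose[OF measurable_pact[OF assms(1)] measurable_SP_section[OF assms(2)]] .
  then show "(\<lambda>l. Qop A p \<phi> (j, l)) \<in> borel_measurable P1"
    unfolding Qop_eq by (intro borel_measurable_sum borel_measurable_times) auto
qed

text \<open>\<open>direction A x\<close> is the line reached from the most recent singular letter of the past
  \<open>x = (\<omega>\<^sub>0, \<omega>\<^sub>-\<^sub>1, \<dots>)\<close>; its initial line is irrelevant as soon as such a letter exists.\<close>

primrec push :: "('a \<Rightarrow> mat2) \<Rightarrow> nat \<Rightarrow> (nat \<Rightarrow> 'a) \<Rightarrow> (real^2) set" where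
  "push A 0 x = pact (A (x 0)) (span {axis 1 1})"
| "push A (Suc n) x = pact (A (x 0)) (push A n (\<lambda>k. x (Suc k)))"

definition direction :: "('a \<Rightarrow> mat2) \<Rightarrow> (nat \<Rightarrow> 'a) \<Rightarrow> (real^2) set" where
  "direction A x = push A (LEAST k. rank (A (x k)) = 1) x"

text \<open>A singular new letter makes both sides its range. An invertible one moves the last
  singular letter one index back, and \<open>push\<close> unfolds once.\<close>

lemma direction_case_nat:
  assumes ex: "\<exists>k. rank (A (x k)) = 1" and types: "rank (A i) = 1 \<or> invertible (A i)"
  shows "direction A (case_nat i x) = pact (A i) (direction A x)"
proof (cases "rank (A i) = 1")
  case True
  then have "(LEAST k. rank (A (case_nat i x k)) = 1) = 0" by (intro Least_eq_0) simp
  then show ?thesis using True by (simp add: direction_def pact_singular)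
next
  case False
  obtain k where "rank (A (x k)) = 1" using ex by blast
  then have "(LEAST k. rank (A (case_nat i x k)) = 1) = Suc (LEAST k. rank (A (case_nat i x (Suc k))) = 1)"
    using False by (intro Least_Suc[of _ "Suc k"]) auto
  then show ?thesis by (simp add: direction_def)
qed

lemma direction_singular: "rank (A (x 0)) = 1 \<Longrightarrow> direction A x = range (\<lambda>v. A (x 0) *v v)"
  by (simp add: direction_def Least_eq_0 pact_singular)

lemma push_lines: "(\<And>i. rank (A i) = 1 \<or> invertible (A i)) \<Longrightarrow> push A n x \<in> lines"
proof (induction n arbitrary: x)
  case 0
  have "span {axis 1 1 :: real^2} \<in> lines" by (auto simp: lines_def axis_eq_0_iff)
  then show ?case using 0 by (simp add: pact_lines)
next
  case (Suc n)
  then show ?case by (simp add: pact_lines)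
qed

lemma direction_lines: "(\<And>i. rank (A i) = 1 \<or> invertible (A i)) \<Longrightarrow> direction A x \<in> lines"
  unfolding direction_def by (rule push_lines)

lemma measurable_direction:
  fixes A :: "'a::finite \<Rightarrow> mat2"
  assumes types: "\<And>i. rank (A i) = 1 \<or> invertible (A i)"
  shows "direction A \<in> PiM UNIV (\<lambda>_. count_space UNIV) \<rightarrow>\<^sub>M P1"
proof -
  let ?N = "PiM UNIV (\<lambda>_::nat. count_space (UNIV :: 'a set))"
  have coord [measurable]: "(\<lambda>x. x k) \<in> ?N \<rightarrow>\<^sub>M count_space UNIV" for k
    by (rule measurable_component_singleton) simp
  have tail: "(\<lambda>x k. x (Suc k)) \<in> ?N \<rightarrow>\<^sub>M ?N"
    by (rule measurable_PiM_single') auto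
  have pact: "(\<lambda>x. pact (A (x 0)) (g x)) \<in> ?N \<rightarrow>\<^sub>M P1" if g: "g \<in> ?N \<rightarrow>\<^sub>M P1" for g
  proof (rule measurable_compose_countable'[where f = "\<lambda>i x. pact (A i) (g x)" and I = UNIV])
    show "(\<lambda>x. pact (A i) (g x)) \<in> ?N \<rightarrow>\<^sub>M P1" for i
      using g measurable_pact[OF types] by (rule measurable_compose)
  qed (simp_all add: countable_finite coord)
  have "push A n \<in> ?N \<rightarrow>\<^sub>M P1" for n
  proof (induction n)
    case 0
    have "push A 0 = (\<lambda>x. pact (A (x 0)) (span {axis 1 1}))" by auto
    have "span {axis 1 1 :: real^2} \<in> space P1" by (auto simp: lines_def axis_eq_0_iff)
    then have "(\<lambda>_. span {axis 1 1}) \<in> ?N \<rightarrow>\<^sub>M P1" by (rule measurable_const)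
    then show ?case unfolding \<open>push A 0 = _\<close> by (rule pact)
  next
    case (Suc n)
    have "push A (Suc n) = (\<lambda>x. pact (A (x 0)) (push A n (\<lambda>k. x (Suc k))))" by auto
    then show ?case using pact[OF measurable_compose[OF tail Suc]] by simp
  qed
  moreover have "(\<lambda>x. LEAST k. rank (A (x k)) = 1) \<in> ?N \<rightarrow>\<^sub>M count_space UNIV"
    by measurable
  ultimately show ?thesis unfolding direction_def by (rule measurable_compose_countable)
qed

section \<open>Extended-real estimates\<close>

text \<open>The positive part has integral at most \<open>C\<close>, so the difference in
  \<open>eintegral\<close> is never infinity minus infinity, and the integral is read off from the
  nonnegative function \<open>C - f\<close>.\<close>

lemma eintegral_bounded_above:
  assumes "prob_space M" and [measurable]: "f \<in> borel_measurable M"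
    and C: "0 \<le> C" "\<And>x. x \<in> space M \<Longrightarrow> f x \<le> ereal C"
  shows "eintegral M f = ereal C - enn2ereal (\<integral>\<^sup>+ x. e2ennreal (ereal C - f x) \<partial>M)"
proof -
  interpret prob_space M by fact
  define a where "a = (\<integral>\<^sup>+ x. e2ennreal (f x) \<partial>M)"
  define b where "b = (\<integral>\<^sup>+ x. e2ennreal (- f x) \<partial>M)"
  define d where "d = (\<integral>\<^sup>+ x. e2ennreal (ereal C - f x) \<partial>M)"
  \<comment> \<open>Stated with sums only, since subtraction in \<open>ennreal\<close>
    truncates.\<close>
  have pw: "e2ennreal (ereal C - y) + e2ennreal y = ennreal C + e2ennreal (- y)" if "y \<le> ereal C" for y
  proof (cases y)
    case (real r)
    then have "r \<le> C" using that by simp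
    then show ?thesis using real C(1)
      by (cases "0 \<le> r") (auto simp: ennreal_neg simp flip: ennreal_plus)
  qed (use that in \<open>auto simp: e2ennreal_neg\<close>)
  have "d + a = (\<integral>\<^sup>+ x. e2ennreal (ereal C - f x) + e2ennreal (f x) \<partial>M)"
    unfolding a_def d_def by (rule nn_integral_add[symmetric]) auto
  also have "\<dots> = (\<integral>\<^sup>+ x. ennreal C + e2ennreal (- f x) \<partial>M)"
    using pw C(2) by (intro nn_integral_cong) auto
  also have "\<dots> = ennreal C + b"
    unfolding b_def by (subst nn_integral_add) (auto simp: emeasure_space_1)
  finally have eq: "d + a = ennreal C + b" .
  have "a \<le> (\<integral>\<^sup>+ x. ennreal C \<partial>M)"
    unfolding a_def
  proof (rule nn_integral_mono)
    show "e2ennreal (f x) \<le> ennreal C" if "x \<in> space M" for x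
      using e2ennreal_mono[OF C(2)[OF that]] by simp
  qed
  then have "a \<le> ennreal C" by (simp add: emeasure_space_1)
  then obtain ra where a: "a = ennreal ra" "0 \<le> ra"
    by (cases a) (auto simp: top_unique)
  have "enn2ereal a - enn2ereal b = ereal C - enn2ereal d"
  proof (cases b)
    case top
    then have "d = top" using eq a by (cases d) (auto simp flip: ennreal_plus)
    then show ?thesis using top a by simp
  next
    case (real rb)
    then have "d \<noteq> top" using eq C(1) by (auto simp: top_add simp flip: ennreal_plus)
    then obtain rd where d: "d = ennreal rd" "0 \<le> rd" by (cases d) auto
    have "rd + ra = C + rb"
      using eq real a d C(1) by (simp flip: ennreal_plus)
    then show ?thesis using real a d by simp
  qed
  then show ?thesis by (simp add: eintegral_def a_def b_def d_def)
qed

text \<open>A weight 0 against the value -infinity counts as 0 on both sides. The upper bound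
  travels through the induction because the gap of a sum splits only when both gaps are
  nonnegative.\<close>

lemma weighted_sum_gap:
  fixes y :: "'a \<Rightarrow> ereal"
  assumes "finite F" "\<And>i. 0 \<le> w i" "\<And>i. y i \<le> ereal C"
  shows "(\<Sum>i\<in>F. ereal (w i) * y i) \<le> ereal (C * sum w F)
    \<and> (\<Sum>i\<in>F. ennreal (w i) * e2ennreal (ereal C - y i))
      = e2ennreal (ereal (C * sum w F) - (\<Sum>i\<in>F. ereal (w i) * y i))"
  using assms(1)
proof (induction F)
  case empty
  show ?case by (simp flip: zero_ereal_def)
next
  case (insert i F)
  define Y where "Y = (\<Sum>i\<in>F. ereal (w i) * y i)"
  define P where "P = sum w F"
  have IH: "Y \<le> ereal (C * P)"
    "(\<Sum>i\<in>F. ennreal (w i) * e2ennreal (ereal C - y i)) = e2ennreal (ereal (C * P) - Y)"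
    using insert.IH by (auto simp: Y_def P_def)
  have wi: "0 \<le> w i" and yi: "y i \<le> ereal C" using assms by auto
  have le: "ereal (w i) * y i \<le> ereal (C * w i)"
    using ereal_mult_left_mono[OF yi, of "ereal (w i)"] wi by (simp add: mult.commute)
  have gap: "ennreal (w i) * e2ennreal (ereal C - y i) = e2ennreal (ereal (C * w i) - ereal (w i) * y i)"
  proof (cases "y i")
    case (real r)
    then show ?thesis using yi wi by (simp add: ennreal_mult'[symmetric] algebra_simps)
  next
    case MInf
    then show ?thesis using wi by (cases "w i = 0") (auto simp: ennreal_mult_top simp flip: zero_ereal_def)
  qed (use yi in simp)
  have add: "e2ennreal (ereal (C * P) - Y) + e2ennreal (ereal (C * w i) - Z)
      = e2ennreal (ereal (C * (w i + P)) - (Z + Y))" if "Z \<le> ereal (C * w i)" for Z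
    using that IH(1)
    by (cases Y; cases Z) (auto simp: algebra_simps simp flip: ennreal_plus)
  have "(\<Sum>i\<in>insert i F. ereal (w i) * y i) = ereal (w i) * y i + Y"
    using insert.hyps by (simp add: Y_def)
  moreover have "ereal (w i) * y i + Y \<le> ereal (C * w i) + ereal (C * P)"
    using le IH(1) by (rule add_mono)
  moreover have "(\<Sum>i\<in>insert i F. ennreal (w i) * e2ennreal (ereal C - y i))
      = e2ennreal (ereal (C * P) - Y) + e2ennreal (ereal (C * w i) - ereal (w i) * y i)"
    using insert.hyps by (simp add: IH(2) gap add.commute)
  moreover have "sum w (insert i F) = w i + P" using insert.hyps by (simp add: P_def)
  ultimately show ?case using add[OF le] by (simp add: algebra_simps)
qed

text \<open>A vanishing factor has infinite gap, so a product that has become 0 corresponds to a sum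
  of gaps that has become infinite.\<close>

lemma eln_prod:
  assumes c: "0 < c" and r: "\<And>k. 0 \<le> r k" "\<And>k. eln (r k) \<le> ereal C"
  shows "eln (c * (\<Prod>k<m. r k))
    = ereal (ln c + real m * C) - enn2ereal (\<Sum>k<m. e2ennreal (ereal C - eln (r k)))"
proof (induction m)
  case 0
  then show ?case using c by (simp add: eln_def zero_ennreal.rep_eq)
next
  case (Suc m)
  define S where "S = (\<Sum>k<m. e2ennreal (ereal C - eln (r k)))"
  define x where "x = c * (\<Prod>k<m. r k)"
  have x0: "0 \<le> x" using c r(1) by (simp add: x_def prod_nonneg)
  have IH: "eln x = ereal (ln c + real m * C) - enn2ereal S" using Suc by (simp add: x_def S_def)
  have "eln (x * r m) = ereal (ln c + real (Suc m) * C) - enn2ereal (S + e2ennreal (ereal C - eln (r m)))"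
  proof (cases "r m = 0")
    case True
    then show ?thesis by (simp add: eln_def)
  next
    case False
    then have rm: "r m > 0" "ln (r m) \<le> C" using r(1)[of m] r(2)[of m] by (auto simp: eln_def)
    show ?thesis
    proof (cases S)
      case top
      then have "x = 0" using IH by (auto simp: eln_def split: if_splits)
      then show ?thesis using top by (simp add: eln_def)
    next
      case (real s)
      then have "x \<noteq> 0" using IH by (auto simp: eln_def)
      then have "x > 0" using x0 by simp
      have "ln x = ln c + real m * C - s" using IH real \<open>x \<noteq> 0\<close> by (simp add: eln_def)
      moreover have "S + e2ennreal (ereal C - eln (r m)) = ennreal (s + (C - ln (r m)))"
        using real rm by (simp add: eln_def flip: ennreal_plus)
      ultimately show ?thesis using rm real \<open>x > 0\<close>
        by (simp add: eln_def ln_mult enn2ereal_ennreal algebra_simps)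
    qed
  qed
  then show ?case by (simp add: x_def S_def mult.assoc)
qed

text \<open>The sum starts at time \<open>t\<close> but is divided by the full time
  \<open>m + t\<close>. The ratio \<open>m / (m + t)\<close> tends to 1, so multiplying by it is
  continuous even at an infinite limit.\<close>

lemma average_limit:
  assumes S: "(\<lambda>m. S m / of_nat m) \<longlonglongrightarrow> (I :: ennreal)"
  shows "(\<lambda>m. (ereal (a + real m * C) - enn2ereal (S m)) / ereal (real (m + t)))
    \<longlonglongrightarrow> ereal C - enn2ereal I"
proof -
  have null: "(\<lambda>m. x / real (m + t)) \<longlonglongrightarrow> 0" for x
    by (rule LIMSEQ_ignore_initial_segment[OF lim_const_over_n])
  have 1: "(\<lambda>m. ereal ((a + real m * C) / real (m + t))) \<longlonglongrightarrow> ereal C"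
  proof (rule tendsto_ereal)
    have "(\<lambda>m. C + (a - real t * C) / real (m + t)) \<longlonglongrightarrow> C + 0"
      by (intro tendsto_add null tendsto_const)
    moreover have "eventually (\<lambda>m. C + (a - real t * C) / real (m + t) = (a + real m * C) / real (m + t)) sequentially"
      using eventually_gt_at_top[of 0] by eventually_elim (simp add: field_simps)
    ultimately show "(\<lambda>m. (a + real m * C) / real (m + t)) \<longlonglongrightarrow> C"
      by (simp add: Lim_transform_eventually)
  qed
  have "(\<lambda>m. real m / real (m + t)) \<longlonglongrightarrow> 1"
  proof -
    have "(\<lambda>m. 1 - real t / real (m + t)) \<longlonglongrightarrow> 1 - 0"
      by (intro tendsto_diff null tendsto_const)
    moreover have "eventually (\<lambda>m. 1 - real t / real (m + t) = real m / real (m + t)) sequentially"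
      using eventually_gt_at_top[of 0] by eventually_elim (simp add: field_simps)
    ultimately show ?thesis by (simp add: Lim_transform_eventually)
  qed
  then have "(\<lambda>m. ereal (real m / real (m + t))) \<longlonglongrightarrow> ereal 1" by (rule tendsto_ereal)
  moreover have "(\<lambda>m. enn2ereal (S m / of_nat m)) \<longlonglongrightarrow> enn2ereal I"
    using S by (rule tendsto_enn2erealI)
  ultimately have "(\<lambda>m. ereal (real m / real (m + t)) * enn2ereal (S m / of_nat m)) \<longlonglongrightarrow> ereal 1 * enn2ereal I"
    by (intro tendsto_mult_ereal) auto
  then have "(\<lambda>m. - (ereal (real m / real (m + t)) * enn2ereal (S m / of_nat m))) \<longlonglongrightarrow> - enn2ereal I"
    by (intro tendsto_uminus_ereal) (simp flip: one_ereal_def)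
  with 1 have "(\<lambda>m. ereal ((a + real m * C) / real (m + t))
      + - (ereal (real m / real (m + t)) * enn2ereal (S m / of_nat m))) \<longlonglongrightarrow> ereal C + - enn2ereal I"
    by (intro tendsto_add_ereal_general2) auto
  moreover have "eventually (\<lambda>m. ereal ((a + real m * C) / real (m + t))
      + - (ereal (real m / real (m + t)) * enn2ereal (S m / of_nat m))
      = (ereal (a + real m * C) - enn2ereal (S m)) / ereal (real (m + t))) sequentially"
    using eventually_gt_at_top[of 0]
  proof eventually_elim
    case (elim m)
    show ?case
    proof (cases "S m")
      case top
      then show ?thesis using elim by (simp add: ennreal_top_divide ennreal_of_nat_eq_real_of_nat)
    next
      case (real s)
      then have "S m / of_nat m = ennreal (s / real m)"
        using elim by (simp add: ennreal_of_nat_eq_real_of_nat divide_ennreal)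
      moreover have "(a + real m * C) / real (m + t) - real m / real (m + t) * (s / real m)
          = (a + real m * C - s) / real (m + t)"
        using elim by (simp add: diff_divide_distrib)
      ultimately show ?thesis using elim real by simp
    qed
  qed
  ultimately show ?thesis by (simp add: Lim_transform_eventually minus_ereal_def)
qed

lemma onorm_scaled:
  assumes "\<And>x. norm (f x) = c * norm (g x)" "bounded_linear g" "0 \<le> c"
  shows "onorm f = c * onorm g"
proof -
  have "onorm f = onorm (\<lambda>x. c *\<^sub>R g x)"
    using assms(1,3) by (simp add: onorm_def)
  then show ?thesis using assms(3) by (simp add: onorm_scaleR[OF assms(2)])
qed

section \<open>The stationary measure\<close>

locale singular_cocycle = markov_shift p q \<mu>
  for p :: "'a::finite \<Rightarrow> 'a \<Rightarrow> real" and q and \<mu> :: "(int \<Rightarrow> 'a) measure" +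
  fixes A :: "'a \<Rightarrow> mat2" and s :: 'a
  assumes types: "\<And>i. rank (A i) = 1 \<or> invertible (A i)" and sing: "rank (A s) = 1"
begin

abbreviation dir :: "(int \<Rightarrow> 'a) \<Rightarrow> (real^2) set" where
  "dir \<omega> \<equiv> direction A (past \<omega>)"

text \<open>Splitting by the last singular letter before time 0 and the word read since then turns
  this law into the explicit series over words.\<close>

definition eta :: "('a \<times> (real^2) set) measure" where
  "eta = distr \<mu> SP (\<lambda>\<omega>. (\<omega> 0, dir \<omega>))"

lemma measurable_state [measurable]: "(\<lambda>\<omega>. (\<omega> 0, dir \<omega>)) \<in> \<mu> \<rightarrow>\<^sub>M SP"
  unfolding SP_def
  by (intro measurable_Pair measurable_coord measurable_compose[OF measurable_past measurable_direction] types)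

lemma sets_eta: "sets eta = sets SP"
  by (simp add: eta_def)

lemma prob_space_eta: "prob_space eta"
  unfolding eta_def by (rule prob_space_distr) measurable

lemma dir_lines: "dir \<omega> \<in> lines"
  by (rule direction_lines) (rule types)

lemma dir_shift:
  assumes "\<exists>k. rank (A (past \<omega> k)) = 1"
  shows "dir (shift \<omega>) = pact (A (\<omega> 1)) (dir \<omega>)"
  unfolding past_shift using assms types by (rule direction_case_nat)

lemma stationary_eta: "stationary A p eta"
  unfolding stationary_def
proof (intro conjI allI impI prob_space_eta sets_eta)
  fix \<phi> :: "'a \<times> (real^2) set \<Rightarrow> real"
  assume \<phi>: "\<phi> \<in> borel_measurable SP" and "\<exists>B. \<forall>x\<in>space SP. \<bar>\<phi> x\<bar> \<le> B"
  then obtain B where B: "\<And>i l. l \<in> lines \<Longrightarrow> \<bar>\<phi> (i, l)\<bar> \<le> B" by fastforce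
  \<comment> \<open>\<open>F\<close> is \<open>\<phi>\<close> at the next state, and
    \<open>G\<close> is its conditional mean given the past. Shift invariance equates the mean of
    \<open>F\<close> with that of \<open>\<phi>\<close>, the Markov property with that of
    \<open>G\<close>.\<close>
  define F where "F \<omega> = \<phi> (\<omega> 1, pact (A (\<omega> 1)) (dir \<omega>))" for \<omega>
  define G where "G \<omega> = Qop A p \<phi> (\<omega> 0, dir \<omega>)" for \<omega>
  have Q: "Qop A p \<phi> \<in> borel_measurable SP" by (rule measurable_Qop[OF types \<phi>])
  have h: "(\<lambda>x. \<phi> (i, pact (A i) (direction A x))) \<in> borel_measurable (PiM UNIV (\<lambda>_. count_space UNIV))" for i
    using measurable_compose[OF measurable_direction[OF types]
        measurable_compose[OF measurable_pact[OF types] measurable_SP_section[OF \<phi>]]] .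
  have F [measurable]: "F \<in> borel_measurable \<mu>"
    unfolding F_def
  proof (rule measurable_compose_countable'[where f = "\<lambda>i \<omega>. \<phi> (i, pact (A i) (dir \<omega>))" and g = "\<lambda>\<omega>. \<omega> 1" and I = UNIV])
    show "(\<lambda>\<omega>. \<phi> (i, pact (A i) (dir \<omega>))) \<in> borel_measurable \<mu>" for i
      using measurable_compose[OF measurable_past h] .
  qed (simp_all add: countable_finite)
  have G [measurable]: "G \<in> borel_measurable \<mu>"
    unfolding G_def using measurable_compose[OF measurable_state Q] .
  have F_bound: "\<bar>F \<omega>\<bar> \<le> B" for \<omega> unfolding F_def by (intro B pact_lines types dir_lines)
  \<comment> \<open>Adding the bound \<open>B\<close> makes the integrands nonnegative, as
    \<open>nn_integral_markov\<close> requires.\<close>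
  have GB: "G \<omega> + B = (\<Sum>i\<in>UNIV. p i (\<omega> 0) * (\<phi> (i, pact (A i) (dir \<omega>)) + B))" for \<omega>
  proof -
    have "(\<Sum>i\<in>UNIV. p i (\<omega> 0) * B) = B" by (simp only: sum_distrib_right[symmetric] p_sum mult_1_left)
    then show ?thesis by (simp add: G_def Qop_eq distrib_left sum.distrib mult.commute)
  qed
  have \<phi>B: "0 \<le> \<phi> (i, pact (A i) (dir \<omega>)) + B" for i \<omega>
    using B[OF pact_lines[OF types dir_lines], of i i \<omega>] by linarith
  have G_bound: "\<bar>G \<omega>\<bar> \<le> B" for \<omega>
  proof -
    have "\<bar>G \<omega>\<bar> \<le> (\<Sum>i\<in>UNIV. \<bar>\<phi> (i, pact (A i) (dir \<omega>)) * p i (\<omega> 0)\<bar>)"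
      unfolding G_def Qop_eq by (rule sum_abs)
    also have "\<dots> \<le> (\<Sum>i\<in>UNIV. B * p i (\<omega> 0))"
      unfolding abs_mult using p_nonneg by (intro sum_mono mult_mono) (auto intro!: B pact_lines types dir_lines order_trans[OF abs_ge_zero B[OF dir_lines]])
    finally show ?thesis by (simp add: sum_distrib_left[symmetric] p_sum)
  qed
  have "(\<integral>\<^sup>+ \<omega>. ennreal (F \<omega> + B) \<partial>\<mu>)
      = (\<integral>\<^sup>+ \<omega>. (\<Sum>i\<in>UNIV. ennreal (p i (\<omega> 0)) * ennreal (\<phi> (i, pact (A i) (dir \<omega>)) + B)) \<partial>\<mu>)"
    unfolding F_def
    by (rule nn_integral_markov[where h = "\<lambda>i x. ennreal (\<phi> (i, pact (A i) (direction A x)) + B)"])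
      (intro measurable_compose[OF _ measurable_ennreal] borel_measurable_add borel_measurable_const h)
  also have "\<dots> = (\<integral>\<^sup>+ \<omega>. ennreal (G \<omega> + B) \<partial>\<mu>)"
    unfolding GB using p_nonneg \<phi>B
    by (intro nn_integral_cong) (simp add: ennreal_mult'[symmetric] sum_ennreal)
  finally have "(\<integral>\<omega>. F \<omega> + B \<partial>\<mu>) = (\<integral>\<omega>. G \<omega> + B \<partial>\<mu>)"
    using F_bound G_bound by (subst (1 2) integral_eq_nn_integral) (auto simp: abs_le_iff intro!: AE_I2, (smt (verit))+)
  moreover have "integrable \<mu> F" "integrable \<mu> G"
    using F_bound G_bound by (auto intro!: integrable_const_bound[of _ B])
  ultimately have "(\<integral>\<omega>. F \<omega> \<partial>\<mu>) = (\<integral>\<omega>. G \<omega> \<partial>\<mu>)" by simp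
  moreover have "(\<integral>x. Qop A p \<phi> x \<partial>eta) = (\<integral>\<omega>. G \<omega> \<partial>\<mu>)"
    unfolding eta_def G_def by (rule integral_distr[OF measurable_state Q])
  moreover have "(\<integral>x. \<phi> x \<partial>eta) = (\<integral>\<omega>. F \<omega> \<partial>\<mu>)"
  proof -
    have m: "(\<lambda>\<omega>. \<phi> (\<omega> 0, dir \<omega>)) \<in> borel_measurable \<mu>"
      using measurable_compose[OF measurable_state \<phi>] .
    have "(\<integral>x. \<phi> x \<partial>eta) = (\<integral>\<omega>. \<phi> (\<omega> 0, dir \<omega>) \<partial>\<mu>)"
      unfolding eta_def by (rule integral_distr[OF measurable_state \<phi>])
    also have "\<dots> = (\<integral>\<omega>. \<phi> (shift \<omega> 0, dir (shift \<omega>)) \<partial>\<mu>)"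
      using integral_comp_T[OF m] by simp
    also have "\<dots> = (\<integral>\<omega>. F \<omega> \<partial>\<mu>)"
    proof (rule integral_cong_AE)
      show "AE \<omega> in \<mu>. \<phi> (shift \<omega> 0, dir (shift \<omega>)) = F \<omega>"
        using AE_visits_past[of s]
      proof eventually_elim
        case (elim \<omega>)
        then have "dir (shift \<omega>) = pact (A (\<omega> 1)) (dir \<omega>)" using sing by (intro dir_shift) auto
        then show ?case by (simp add: F_def shift_def)
      qed
      show "(\<lambda>\<omega>. \<phi> (shift \<omega> 0, dir (shift \<omega>))) \<in> borel_measurable \<mu>"
        using measurable_compose[OF measurable_shift m] .
    qed (rule F)
    finally show ?thesis .
  qed
  ultimately show "(\<integral>x. Qop A p \<phi> x \<partial>eta) = (\<integral>x. \<phi> x \<partial>eta)" by simp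
qed

section \<open>Uniqueness of the stationary measure\<close>

lemma Qop_iterate_bounds:
  assumes \<phi>: "\<And>i l. l \<in> lines \<Longrightarrow> 0 \<le> \<phi> (i, l) \<and> \<phi> (i, l) \<le> 1" and l: "l \<in> lines"
  shows "0 \<le> (Qop A p ^^ n) \<phi> (j, l) \<and> (Qop A p ^^ n) \<phi> (j, l) \<le> 1"
  using l
proof (induction n arbitrary: j l)
  case (Suc n)
  let ?\<psi> = "\<lambda>i. (Qop A p ^^ n) \<phi> (i, pact (A i) l)"
  have \<psi>: "0 \<le> ?\<psi> i" "?\<psi> i \<le> 1" for i
    using Suc.IH[OF pact_lines[OF types Suc.prems], of i i] by auto
  have "(\<Sum>i\<in>UNIV. ?\<psi> i * p i j) \<le> (\<Sum>i\<in>UNIV. p i j)"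
    using \<psi> p_nonneg by (intro sum_mono mult_left_le_one_le) auto
  moreover have "0 \<le> (\<Sum>i\<in>UNIV. ?\<psi> i * p i j)"
    using \<psi> p_nonneg by (intro sum_nonneg) auto
  ultimately show ?case by (simp add: Qop_eq p_sum)
qed (use \<phi> in simp)

text \<open>A singular letter makes the state forget its line.\<close>

lemma Qop_iterate_oscillation:
  assumes \<phi>: "\<And>i l. l \<in> lines \<Longrightarrow> 0 \<le> \<phi> (i, l) \<and> \<phi> (i, l) \<le> 1"
    and l: "l \<in> lines" "l' \<in> lines"
  shows "\<bar>(Qop A p ^^ n) \<phi> (j, l) - (Qop A p ^^ n) \<phi> (j, l')\<bar> \<le> avoid {i. rank (A i) = 1} n j"
  using l
proof (induction n arbitrary: j l l')
  case 0
  then show ?case using \<phi>[of l j] \<phi>[of l' j] by auto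
next
  case (Suc n)
  let ?\<psi> = "(Qop A p ^^ n) \<phi>" and ?S = "{i. rank (A i) = 1}"
  have "(Qop A p ^^ Suc n) \<phi> (j, l) - (Qop A p ^^ Suc n) \<phi> (j, l')
      = (\<Sum>i\<in>UNIV. p i j * (?\<psi> (i, pact (A i) l) - ?\<psi> (i, pact (A i) l')))"
    by (simp add: Qop_eq sum_subtractf[symmetric] algebra_simps)
  also have "\<dots> = (\<Sum>i\<in>-?S. p i j * (?\<psi> (i, pact (A i) l) - ?\<psi> (i, pact (A i) l')))"
    by (rule sum.mono_neutral_right) (auto simp: pact_singular)
  also have "\<bar>\<dots>\<bar> \<le> (\<Sum>i\<in>-?S. p i j * avoid ?S n i)"
    using Suc.IH[OF pact_lines[OF types Suc.prems(1)] pact_lines[OF types Suc.prems(2)]] p_nonneg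
    by (intro order_trans[OF sum_abs] sum_mono) (auto simp: abs_mult intro!: mult_left_mono)
  finally show ?case by simp
qed

text \<open>\<open>Qop\<close> sends the indicator of the letter \<open>i\<close> to
  \<open>p i (fst x)\<close>, so the letter marginal of a stationary measure is a fixed vector of
  \<open>p\<close>.\<close>

lemma stationary_marginal:
  assumes "stationary A p \<nu>"
  shows "(\<integral>x. f (fst x) \<partial>\<nu>) = (\<Sum>j\<in>UNIV. f j * q j)"
proof -
  interpret N: prob_space \<nu> using assms by (simp add: stationary_def)
  have sets: "sets \<nu> = sets SP" using assms by (simp add: stationary_def)
  define h where "h i x = (if fst x = i then 1 else 0 :: real)" for i :: 'a and x :: "'a \<times> (real^2) set"
  have meas: "(\<lambda>x. g (fst x)) \<in> borel_measurable SP" for g :: "'a \<Rightarrow> real"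
    by (rule measurable_SPI) simp
  have h_meas: "h i \<in> borel_measurable SP" for i
    unfolding h_def using meas[of "\<lambda>j. if j = i then 1 else 0"] .
  have h_int: "integrable \<nu> (h i)" for i
  proof (rule N.integrable_const_bound[of _ 1])
    show "h i \<in> borel_measurable \<nu>" using h_meas sets by (simp cong: measurable_cong_sets)
  qed (simp add: h_def)
  have expand: "(\<integral>x. g (fst x) \<partial>\<nu>) = (\<Sum>j\<in>UNIV. g j * (\<integral>x. h j x \<partial>\<nu>))" for g :: "'a \<Rightarrow> real"
  proof -
    have "g (fst x) = (\<Sum>j\<in>UNIV. g j * h j x)" for x :: "'a \<times> (real^2) set"
      by (simp add: h_def if_distrib cong: if_cong)
    then have "(\<integral>x. g (fst x) \<partial>\<nu>) = (\<integral>x. (\<Sum>j\<in>UNIV. g j * h j x) \<partial>\<nu>)" by simp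
    then show ?thesis using h_int by (simp add: Bochner_Integration.integral_sum)
  qed
  have "(\<lambda>j. \<integral>x. h j x \<partial>\<nu>) = q"
  proof (rule stationary_vector_unique)
    fix i
    have "Qop A p (h i) = (\<lambda>x. p i (fst x))"
      by (auto simp: fun_eq_iff Qop_eq h_def if_distrib[of "\<lambda>y. y * _"] cong: if_cong)
    moreover have "(\<integral>x. Qop A p (h i) x \<partial>\<nu>) = (\<integral>x. h i x \<partial>\<nu>)"
    proof -
      have "\<exists>B. \<forall>x\<in>space SP. \<bar>h i x\<bar> \<le> B" by (intro exI[of _ 1]) (simp add: h_def)
      then show ?thesis using assms h_meas[of i] unfolding stationary_def by blast
    qed
    ultimately show "(\<Sum>j\<in>UNIV. p i j * (\<integral>x. h j x \<partial>\<nu>)) = (\<integral>x. h i x \<partial>\<nu>)"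
      using expand[of "p i"] by simp
  next
    show "(\<Sum>j\<in>UNIV. \<integral>x. h j x \<partial>\<nu>) = 1" using expand[of "\<lambda>_. 1"] by (simp add: N.prob_space)
  qed
  then show ?thesis using expand[of f] by (simp add: fun_eq_iff)
qed

text \<open>The sequence does not mention \<open>\<nu>\<close>, so all stationary measures share its
  limit. Stationarity keeps the integral of the iterates constant, and fixing their line at
  \<open>l\<close> costs at most their oscillation.\<close>

lemma stationary_integral_limit:
  assumes \<nu>: "stationary A p \<nu>" and l: "l \<in> lines"
    and meas: "\<phi> \<in> borel_measurable SP"
    and \<phi>: "\<And>i l. l \<in> lines \<Longrightarrow> 0 \<le> \<phi> (i, l) \<and> \<phi> (i, l) \<le> 1"
  shows "(\<lambda>n. \<Sum>j\<in>UNIV. (Qop A p ^^ n) \<phi> (j, l) * q j) \<longlonglongrightarrow> (\<integral>x. \<phi> x \<partial>\<nu>)"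
proof -
  interpret N: prob_space \<nu> using \<nu> by (simp add: stationary_def)
  have sets: "sets \<nu> = sets SP" using \<nu> by (simp add: stationary_def)
  have space: "space \<nu> = UNIV \<times> lines" using sets_eq_imp_space_eq[OF sets] by simp
  let ?\<psi> = "\<lambda>n. (Qop A p ^^ n) \<phi>" and ?S = "{i. rank (A i) = 1}"
  have \<psi>_meas: "?\<psi> n \<in> borel_measurable SP" for n
  proof (induction n)
    case (Suc n)
    then show ?case using measurable_Qop[OF types Suc] by simp
  qed (simp add: meas)
  have bounds: "0 \<le> ?\<psi> n x \<and> ?\<psi> n x \<le> 1" if "x \<in> UNIV \<times> lines" for n x
    using Qop_iterate_bounds[of \<phi>, OF \<phi>, of "snd x" n "fst x"] that by auto
  have abs_bound: "\<bar>?\<psi> n x\<bar> \<le> 1" if "x \<in> UNIV \<times> lines" for n x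
    using bounds[OF that, of n] by linarith
  have \<psi>_integral: "(\<integral>x. ?\<psi> n x \<partial>\<nu>) = (\<integral>x. \<phi> x \<partial>\<nu>)" for n
  proof (induction n)
    case (Suc n)
    have "\<exists>B. \<forall>x\<in>space SP. \<bar>?\<psi> n x\<bar> \<le> B" using abs_bound by (intro exI[of _ 1]) simp
    then have "(\<integral>x. Qop A p (?\<psi> n) x \<partial>\<nu>) = (\<integral>x. ?\<psi> n x \<partial>\<nu>)"
      using \<nu> \<psi>_meas[of n] unfolding stationary_def by blast
    then show ?case using Suc by simp
  qed simp
  have \<psi>_int: "integrable \<nu> (?\<psi> n)" for n
  proof (rule N.integrable_const_bound[of _ 1])
    show "?\<psi> n \<in> borel_measurable \<nu>"
      unfolding measurable_cong_sets[OF sets refl] by (rule \<psi>_meas)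
    show "AE x in \<nu>. norm (?\<psi> n x) \<le> 1"
      by (rule AE_I2) (simp only: space real_norm_def abs_bound)
  qed
  have const_int: "integrable \<nu> (\<lambda>x. ?\<psi> n (fst x, l))" for n
  proof (rule N.integrable_const_bound[of _ 1])
    show "(\<lambda>x. ?\<psi> n (fst x, l)) \<in> borel_measurable \<nu>"
      unfolding measurable_cong_sets[OF sets refl] by (rule measurable_SPI) simp
    show "AE x in \<nu>. norm (?\<psi> n (fst x, l)) \<le> 1"
      using l by (intro AE_I2) (simp only: real_norm_def abs_bound mem_Times_iff fst_conv snd_conv UNIV_I simp_thms)
  qed
  \<comment> \<open>Summing over the letters makes the oscillation bound independent of the
    state.\<close>
  define e where "e n = (\<Sum>j\<in>UNIV. avoid ?S n j)" for n
  have dist: "\<bar>(\<Sum>j\<in>UNIV. ?\<psi> n (j, l) * q j) - (\<integral>x. \<phi> x \<partial>\<nu>)\<bar> \<le> e n" for n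
  proof -
    have "(\<Sum>j\<in>UNIV. ?\<psi> n (j, l) * q j) - (\<integral>x. \<phi> x \<partial>\<nu>)
        = (\<integral>x. ?\<psi> n (fst x, l) \<partial>\<nu>) - (\<integral>x. ?\<psi> n x \<partial>\<nu>)"
      unfolding stationary_marginal[OF \<nu>, of "\<lambda>j. ?\<psi> n (j, l)"] \<psi>_integral ..
    also have "\<dots> = (\<integral>x. ?\<psi> n (fst x, l) - ?\<psi> n x \<partial>\<nu>)"
      by (rule Bochner_Integration.integral_diff[symmetric, OF const_int \<psi>_int])
    also have "\<bar>\<dots>\<bar> \<le> (\<integral>x. \<bar>?\<psi> n (fst x, l) - ?\<psi> n x\<bar> \<partial>\<nu>)"
      by (rule integral_abs_bound)
    also have "\<dots> \<le> (\<integral>x. e n \<partial>\<nu>)"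
    proof (rule integral_mono)
      fix x assume "x \<in> space \<nu>"
      then have "\<bar>?\<psi> n (fst x, l) - ?\<psi> n (fst x, snd x)\<bar> \<le> avoid ?S n (fst x)"
        using l by (intro Qop_iterate_oscillation \<phi>) (auto simp: space)
      also have "\<dots> \<le> e n" unfolding e_def by (rule member_le_sum) (auto simp: avoid_nonneg)
      finally show "\<bar>?\<psi> n (fst x, l) - ?\<psi> n x\<bar> \<le> e n" by simp
    qed (use const_int \<psi>_int in auto)
    finally show ?thesis by (simp add: N.prob_space)
  qed
  have e: "e \<longlonglongrightarrow> 0"
  proof -
    have "?S \<noteq> {}" using sing by auto
    then have "(\<lambda>n. \<Sum>j\<in>UNIV. avoid ?S n j) \<longlonglongrightarrow> (\<Sum>j\<in>(UNIV::'a set). 0)"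
      by (intro tendsto_sum avoid_limit)
    then show ?thesis by (simp add: e_def[abs_def])
  qed
  have "(\<lambda>n. (\<Sum>j\<in>UNIV. ?\<psi> n (j, l) * q j) - (\<integral>x. \<phi> x \<partial>\<nu>)) \<longlonglongrightarrow> 0"
    by (rule Lim_null_comparison[OF always_eventually e]) (simp only: real_norm_def dist simp_thms)
  then show ?thesis by (rule LIM_zero_cancel)
qed

lemma stationary_unique:
  assumes "stationary A p \<nu>"
  shows "\<nu> = eta"
proof (rule measure_eqI)
  have sets: "sets \<nu> = sets SP" and N: "prob_space \<nu>" using assms by (simp_all add: stationary_def)
  show "sets \<nu> = sets eta" by (simp add: sets sets_eta)
  fix S assume S: "S \<in> sets \<nu>"
  have l: "span {axis 1 1 :: real^2} \<in> lines" by (auto simp: lines_def axis_eq_0_iff)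
  have meas: "(indicator S :: _ \<Rightarrow> real) \<in> borel_measurable SP" using S sets by simp
  have "(\<integral>x. indicator S x \<partial>\<nu>) = (\<integral>x. indicator S x \<partial>eta :: real)"
    using LIMSEQ_unique[OF stationary_integral_limit[OF assms l meas] stationary_integral_limit[OF stationary_eta l meas]]
    by (simp add: indicator_def)
  moreover have "S \<subseteq> space \<nu>" "S \<subseteq> space eta"
    using S sets.sets_into_space sets sets_eta by blast+
  ultimately have "measure \<nu> S = measure eta S" by (simp add: Int_absorb2)
  then show "emeasure \<nu> S = emeasure eta S"
    using finite_measure.emeasure_eq_measure prob_space.finite_measure N prob_space_eta by metis
qed

end

section \<open>The Lyapunov exponent\<close>

context singular_cocycle
begin

text \<open>Equality may fail: a later singular matrix can annihilate the line, leaving range 0,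
  while \<open>dir\<close> moves to the range of that matrix.\<close>

lemma range_cocycle_subset:
  assumes t: "t \<ge> 1" "rank (A (\<omega> (int t))) = 1"
  shows "range (\<lambda>x. cocycle A \<omega> (t + m) *v x) \<subseteq> dir ((shift ^^ (t + m)) \<omega>)"
proof (induction m)
  case 0
  obtain r where r: "t = Suc r" using t(1) by (cases t) auto
  have "past ((shift ^^ t) \<omega>) 0 = \<omega> (int t)" by (simp add: past_def shift_funpow)
  then have "dir ((shift ^^ t) \<omega>) = range (\<lambda>x. A (\<omega> (int t)) *v x)"
    using t(2) direction_singular[of A "past ((shift ^^ t) \<omega>)"] by simp
  then show ?case by (auto simp: r matrix_vector_mul_assoc[symmetric])
next
  case (Suc m)
  let ?\<omega> = "(shift ^^ (t + m)) \<omega>"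
  have "past ?\<omega> m = \<omega> (int t)" by (simp add: past_def shift_funpow)
  then have "dir (shift ?\<omega>) = pact (A (?\<omega> 1)) (dir ?\<omega>)"
    using t(2) by (intro dir_shift exI[of _ m]) simp
  moreover have "?\<omega> 1 = \<omega> (int (Suc (t + m)))" by (simp add: shift_funpow add.commute)
  ultimately have "(\<lambda>v. A (\<omega> (int (Suc (t + m)))) *v v) ` dir ?\<omega> \<subseteq> dir ((shift ^^ (t + Suc m)) \<omega>)"
    using image_subset_pact[of "A (?\<omega> 1)" "dir ?\<omega>"] by simp
  then show ?case using Suc by (auto simp: matrix_vector_mul_assoc[symmetric])
qed

definition growth :: "(int \<Rightarrow> 'a) \<Rightarrow> real" where
  "growth \<omega> = stretch (A (\<omega> 1)) (dir \<omega>)"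

text \<open>All vectors in the range lie on one line and are stretched by one factor, so the
  operator norm scales exactly, even by a factor 0.\<close>

lemma mnorm_cocycle_Suc:
  assumes "t \<ge> 1" "rank (A (\<omega> (int t))) = 1"
  shows "mnorm (cocycle A \<omega> (t + Suc m)) = growth ((shift ^^ (t + m)) \<omega>) * mnorm (cocycle A \<omega> (t + m))"
  unfolding mnorm_def
proof (rule onorm_scaled)
  let ?\<omega> = "(shift ^^ (t + m)) \<omega>"
  fix x
  have "cocycle A \<omega> (t + m) *v x \<in> dir ?\<omega>"
    using range_cocycle_subset[of t \<omega>, OF assms, of m] by blast
  moreover have "?\<omega> 1 = \<omega> (int (Suc (t + m)))" by (simp add: shift_funpow add.commute)
  ultimately show "norm (cocycle A \<omega> (t + Suc m) *v x)
      = growth ?\<omega> * norm (cocycle A \<omega> (t + m) *v x)"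
    using norm_mult_line[OF dir_lines] by (simp add: growth_def matrix_vector_mul_assoc[symmetric])
qed (simp_all add: matrix_vector_mul_bounded_linear growth_def stretch_nonneg)

lemma mnorm_cocycle:
  assumes "t \<ge> 1" "rank (A (\<omega> (int t))) = 1"
  shows "mnorm (cocycle A \<omega> (t + m))
    = mnorm (cocycle A \<omega> t) * (\<Prod>k<m. growth ((shift ^^ (t + k)) \<omega>))"
  by (induction m) (simp_all add: mnorm_cocycle_Suc[of t \<omega>, OF assms] mult_ac del: add_Suc_right)

text \<open>An invertible product followed by a nonzero matrix is nonzero. This makes the logarithm
  of the initial norm finite.\<close>

lemma mnorm_first_singular_pos:
  assumes t: "t \<ge> 1" "rank (A (\<omega> (int t))) = 1"
    and first: "\<And>k. 1 \<le> k \<Longrightarrow> k < t \<Longrightarrow> rank (A (\<omega> (int k))) \<noteq> 1"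
  shows "0 < mnorm (cocycle A \<omega> t)"
proof -
  obtain r where r: "t = Suc r" using t(1) by (cases t) auto
  have "invertible (cocycle A \<omega> k)" if "k < t" for k
    using that
  proof (induction k)
    case 0
    show ?case by (auto simp: invertible_def intro: exI[of _ "mat 1"])
  next
    case (Suc k)
    then have "invertible (A (\<omega> (int (Suc k))))" using first[of "Suc k"] types by auto
    then show ?case using Suc by (simp add: invertible_mult)
  qed
  \<comment> \<open>Cancelling the invertible product with \<open>B\<close> would make the singular
    matrix itself 0, against rank 1.\<close>
  then obtain B where B: "cocycle A \<omega> r ** B = mat 1" using r by (auto simp: invertible_def)
  have "cocycle A \<omega> t \<noteq> 0"
  proof
    assume "cocycle A \<omega> t = 0"
    then have "A (\<omega> (int t)) ** (cocycle A \<omega> r ** B) = 0 ** B"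
      by (simp add: r matrix_mul_assoc del: of_nat_Suc)
    also have "\<dots> = 0" by (simp add: matrix_matrix_mult_def vec_eq_iff)
    finally have "A (\<omega> (int t)) ** (cocycle A \<omega> r ** B) = 0" .
    then have "A (\<omega> (int t)) = 0" by (simp add: B)
    then show False using t(2) by (simp add: rank_eq_0)
  qed
  then obtain x where "cocycle A \<omega> t *v x \<noteq> 0" by (metis matrix_eq matrix_vector_mult_0)
  then have "mnorm (cocycle A \<omega> t) \<noteq> 0"
    unfolding mnorm_def using onorm_eq_0[OF matrix_vector_mul_bounded_linear[of "cocycle A \<omega> t"]] by auto
  then show ?thesis
    using mnorm_nonneg[of "cocycle A \<omega> t"] by linarith
qed

text \<open>The sum dominates every single norm; the summand 1 makes the logarithm nonnegative, as
  \<open>eintegral_bounded_above\<close> demands.\<close>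

definition bound :: real where
  "bound = ln (1 + (\<Sum>i\<in>UNIV. mnorm (A i)))"

lemma bound_nonneg: "0 \<le> bound"
  by (simp add: bound_def sum_nonneg mnorm_nonneg)

lemma eln_stretch_le: "eln (stretch (A i) l) \<le> ereal bound"
proof (cases "stretch (A i) l = 0")
  case False
  then have pos: "0 < stretch (A i) l" using stretch_nonneg[of "A i" l] by linarith
  have "mnorm (A i) \<le> (\<Sum>i\<in>UNIV. mnorm (A i))"
    by (rule member_le_sum) (auto simp: mnorm_nonneg)
  then have "stretch (A i) l \<le> 1 + (\<Sum>i\<in>UNIV. mnorm (A i))"
    using stretch_le_mnorm[of "A i" l] by linarith
  then have "ln (stretch (A i) l) \<le> bound" unfolding bound_def using pos by (intro ln_mono) auto
  then show ?thesis using False by (simp add: eln_def)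
qed (simp add: eln_def)

text \<open>Passing from \<open>eln growth\<close>, which may be \<open>-\<infinity>\<close> or have infinite mean, to its distance from an
  upper bound makes the nonnegative ergodic theorem applicable without integrability.\<close>

definition gap :: "(int \<Rightarrow> 'a) \<Rightarrow> ennreal" where
  "gap \<omega> = e2ennreal (ereal bound - eln (growth \<omega>))"

lemma measurable_direction_stretch:
  "(\<lambda>x. e2ennreal (ereal bound - eln (stretch M (direction A x)))) \<in> borel_measurable (PiM UNIV (\<lambda>_. count_space UNIV))"
proof -
  have [measurable]: "direction A \<in> PiM UNIV (\<lambda>_. count_space UNIV) \<rightarrow>\<^sub>M P1"
    by (rule measurable_direction) (rule types)
  show ?thesis by measurable
qed

lemma measurable_gap [measurable]: "gap \<in> borel_measurable \<mu>"
  unfolding gap_def growth_def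
proof (rule measurable_compose_countable'[where f = "\<lambda>i \<omega>. e2ennreal (ereal bound - eln (stretch (A i) (dir \<omega>)))"
      and g = "\<lambda>\<omega>. \<omega> 1" and I = UNIV])
  show "(\<lambda>\<omega>. e2ennreal (ereal bound - eln (stretch (A i) (dir \<omega>)))) \<in> borel_measurable \<mu>" for i
    using measurable_compose[OF measurable_past measurable_direction_stretch] .
qed (simp_all add: countable_finite)

lemma Psi_gap:
  "Psi A p (j, l) \<le> ereal bound"
  "(\<Sum>i\<in>UNIV. ennreal (p i j) * e2ennreal (ereal bound - eln (stretch (A i) l)))
    = e2ennreal (ereal bound - Psi A p (j, l))"
  using weighted_sum_gap[of UNIV "\<lambda>i. p i j" "\<lambda>i. eln (stretch (A i) l)" bound]
  by (simp_all add: p_nonneg eln_stretch_le Psi_eq p_sum)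

text \<open>The gap at the next letter is averaged over that letter given the past, which gives the
  gap of \<open>Psi\<close> at the current state, and \<open>eta\<close> is the law of that
  state.\<close>

lemma integral_Psi: "eintegral eta (Psi A p) = ereal bound - enn2ereal (\<integral>\<^sup>+ \<omega>. gap \<omega> \<partial>\<mu>)"
proof -
  have Psi_eta: "Psi A p \<in> borel_measurable eta"
    unfolding measurable_cong_sets[OF sets_eta refl] by (rule measurable_Psi)
  have "(\<integral>\<^sup>+ \<omega>. gap \<omega> \<partial>\<mu>)
      = (\<integral>\<^sup>+ \<omega>. (\<Sum>i\<in>UNIV. ennreal (p i (\<omega> 0)) * e2ennreal (ereal bound - eln (stretch (A i) (dir \<omega>)))) \<partial>\<mu>)"
    unfolding gap_def growth_def
    by (rule nn_integral_markov) (rule measurable_direction_stretch)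
  also have "\<dots> = (\<integral>\<^sup>+ \<omega>. e2ennreal (ereal bound - Psi A p (\<omega> 0, dir \<omega>)) \<partial>\<mu>)"
    unfolding Psi_gap(2) ..
  also have "\<dots> = (\<integral>\<^sup>+ x. e2ennreal (ereal bound - Psi A p x) \<partial>eta)"
    unfolding eta_def by (rule nn_integral_distr[symmetric]) measurable
  finally have "(\<integral>\<^sup>+ \<omega>. gap \<omega> \<partial>\<mu>) = (\<integral>\<^sup>+ x. e2ennreal (ereal bound - Psi A p x) \<partial>eta)" .
  moreover have "eintegral eta (Psi A p) = ereal bound - enn2ereal (\<integral>\<^sup>+ x. e2ennreal (ereal bound - Psi A p x) \<partial>eta)"
    by (rule eintegral_bounded_above[OF prob_space_eta Psi_eta bound_nonneg]) (use Psi_gap(1) in auto)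
  ultimately show ?thesis by simp
qed

text \<open>The starting time \<open>t\<close> depends on the sequence, so ergodic averages are
  needed from every point of the orbit; \<open>AE_funpow\<close> supplies them outside one null
  set.\<close>

theorem Lyapunov_exponent:
  "AE \<omega> in \<mu>. (\<lambda>n. eln (mnorm (cocycle A \<omega> n)) / ereal (real n)) \<longlonglongrightarrow> eintegral eta (Psi A p)"
  using AE_funpow[OF birkhoff_ennreal[OF measurable_gap]] AE_visits_future[of s]
proof eventually_elim
  case (elim \<omega>)
  define t where "t = (LEAST k. k \<ge> 1 \<and> rank (A (\<omega> (int k))) = 1)"
  have "\<exists>k\<ge>1. rank (A (\<omega> (int k))) = 1" using elim(2) sing by auto
  then have t: "t \<ge> 1" "rank (A (\<omega> (int t))) = 1" unfolding t_def by (metis (mono_tags, lifting) LeastI_ex)+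
  have first: "rank (A (\<omega> (int k))) \<noteq> 1" if "1 \<le> k" "k < t" for k
    using that not_less_Least unfolding t_def by blast
  define c where "c = mnorm (cocycle A \<omega> t)"
  have c: "0 < c" unfolding c_def by (rule mnorm_first_singular_pos[of t \<omega>, OF t first])
  \<comment> \<open>The average is restarted at time \<open>t\<close>: earlier gaps may be infinite.\<close>
  let ?r = "\<lambda>k. growth ((shift ^^ (t + k)) \<omega>)"
  let ?S = "\<lambda>m. \<Sum>k<m. gap ((shift ^^ (t + k)) \<omega>)"
  have "eln (mnorm (cocycle A \<omega> (m + t))) = ereal (ln c + real m * bound) - enn2ereal (?S m)" for m
  proof -
    have "mnorm (cocycle A \<omega> (m + t)) = c * (\<Prod>k<m. ?r k)"
      using mnorm_cocycle[of t \<omega>, OF t, of m] by (simp add: c_def add.commute)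
    moreover have "eln (c * (\<Prod>k<m. ?r k)) = ereal (ln c + real m * bound) - enn2ereal (?S m)"
      unfolding gap_def
      by (rule eln_prod[OF c]) (auto simp: growth_def stretch_nonneg eln_stretch_le)
    ultimately show ?thesis by simp
  qed
  moreover have "(\<lambda>m. ?S m / of_nat m) \<longlonglongrightarrow> (\<integral>\<^sup>+ \<omega>. gap \<omega> \<partial>\<mu>)"
  proof -
    have "(shift ^^ k) ((shift ^^ t) \<omega>) = (shift ^^ (t + k)) \<omega>" for k
      by (simp add: shift_funpow add_ac)
    then show ?thesis using elim(1)[rule_format, of t] by simp
  qed
  ultimately have "(\<lambda>m. eln (mnorm (cocycle A \<omega> (m + t))) / ereal (real (m + t)))
      \<longlonglongrightarrow> eintegral eta (Psi A p)"
    unfolding integral_Psi using average_limit[of ?S _ "ln c" bound t] by simp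
  then show ?case by (rule LIMSEQ_offset)
qed

end

theorem theorem2p2:
  fixes A :: "'a::finite \<Rightarrow> real^2^2"
    and p :: "'a \<Rightarrow> 'a \<Rightarrow> real"
    and q :: "'a \<Rightarrow> real"
    and \<mu> :: "(int \<Rightarrow> 'a) measure"
  assumes types: "\<forall>i. rank (A i) = 1 \<or> invertible (A i)"
    and sing_ne: "\<exists>i. rank (A i) = 1"
    and inv_ne: "\<exists>i. invertible (A i)"
    and stoch: "left_stochastic p"
    and prim: "primitive p"
    and q_prob: "\<forall>j. 0 \<le> q j" "(\<Sum>j\<in>UNIV. q j) = 1"
    and q_inv: "\<forall>i. (\<Sum>j\<in>UNIV. p i j * q j) = q i"
    and mu: "markov_measure p q \<mu>"
  shows "\<exists>\<eta>. stationary A p \<eta> \<and> (\<forall>\<eta>'. stationary A p \<eta>' \<longrightarrow> \<eta>' = \<eta>) \<and>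
           (AE \<omega> in \<mu>. (\<lambda>n. eln (mnorm (cocycle A \<omega> n)) / ereal (real n))
                         \<longlonglongrightarrow> eintegral \<eta> (Psi A p))"
proof -
  obtain s where "rank (A s) = 1" using sing_ne by blast
  then interpret singular_cocycle p q \<mu> A s
    using types stoch prim q_prob q_inv mu by unfold_locales auto
  show ?thesis
    using stationary_eta stationary_unique Lyapunov_exponent by blast
qed

end
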